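(* Let $p\ge 2$, $q\ge 1$, $n=p+q$, $V=\mathbb R^{p,q}$. Then for every $f\in\mathcal S(\mathbb R^{n})$ the following system of functional equations holds (as an identity of meromorphic functions of $s\in\mathbb C$): $$ \begin{bmatrix} Z_+(\widehat f, s)\\ Z_-(\widehat f, s) \end{bmatrix}= \gamma(s)\,\mathbf A(s) \begin{bmatrix} Z_+\big(f, -s-\frac{n}{2}\big) \\ Z_-\big(f, -s-\frac{n}{2}\big) \end{bmatrix}, $$ where $$\mathbf{A}(s)= \begin{bmatrix} \cos\frac{(p-q)\pi}{4} \left(\sin \frac{n\pi}{4}-\sin\big((s+\frac{n}{4}) \pi\big) \right) & \sin\frac{(p-q)\pi}{4} \left(\cos\big((s+\frac{n}{4}) \pi\big)- \cos \frac{n\pi}{4}\right)\\ \sin\frac{(p-q)\pi}{4} \left(\cos\big((s+\frac{n}{4}) \pi\big)+ \cos \frac{n\pi}{4}\right) & -\cos\frac{(p-q)\pi}{4} \left(\sin \frac{n\pi}{4}+\sin\big((s+\frac{n}{4}) \pi\big) \right) \end{bmatrix} $$ and $$\gamma(s) = 2^{2s+n}\,\pi^{\frac{n}{2}-1}\, \Gamma(s+1)\,\Gamma\big(s+\tfrac{n}{2}\big).$$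
   Context: On $V=\mathbb R^{p,q}=\mathbb R^n$, $n=p+q$, put $P(x)=x_1^2+\cdots+x_p^2-x_{p+1}^2-\cdots-x_n^2$; this is the Jordan determinant ${\bf det}(x)$ of the real Jordan algebra $\mathbb R^{p,q}$. For $s\in\mathbb C$ and $P(x)\neq 0$ set ${\bf det}(x)^{s,+}=|P(x)|^s$ and ${\bf det}(x)^{s,-}=\operatorname{sign}(P(x))\,|P(x)|^s$. For $f$ in the Schwartz space $\mathcal S(\mathbb R^n)$ and $\varepsilon\in\{+,-\}$, $Z_\varepsilon(f,s)=\int_{\mathbb R^n} f(x)\,{\bf det}(x)^{s,\varepsilon}\,dx$, with $dx$ the standard Lebesgue measure. The integral converges for $\operatorname{Re} s>0$ and $Z_\varepsilon(f,\cdot)$ extends meromorphically to $\mathbb C$; the extension is denoted by the same symbol. For this $V$ the Fourier transform is $\widehat f(x)=\int_{\mathbb R^n} e^{i\langle x,y\rangle} f(y)\,dy$, where $\langle x,y\rangle=\sum_{j=1}^n x_jy_j$. (Replacing $\langle x,y\rangle$ by the symmetric bilinear form associated with $P$ does not change the values $Z_\varepsilon(\widehat f,s)$.) *)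

theory Defs
  imports "HOL-Complex_Analysis.Complex_Analysis"
begin

(* The space R^{p,q} is modelled as real^('p + 'q) with CARD('p) = p and CARD('q) = q:
   the coordinates Inl i carry the positive squares of the quadratic form, the
   coordinates Inr j the negative ones.  As a Euclidean space this is the standard R^(p+q). *)

definition jdet :: "real ^ ('p::finite + 'q::finite) \<Rightarrow> real" where
  "jdet x = (\<Sum>i\<in>UNIV. (x $ Inl i)\<^sup>2) - (\<Sum>j\<in>UNIV. (x $ Inr j)\<^sup>2)"

datatype parity = Plus | Minus

text \<open>Only meaningful where \<open>jdet x \<noteq> 0\<close>; the zero set of \<open>jdet\<close> is a null set.\<close>

fun jdet_pow :: "parity \<Rightarrow> complex \<Rightarrow> real ^ ('p::finite + 'q::finite) \<Rightarrow> complex" where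
  "jdet_pow Plus s x = complex_of_real \<bar>jdet x\<bar> powr s"
| "jdet_pow Minus s x = complex_of_real (sgn (jdet x)) * complex_of_real \<bar>jdet x\<bar> powr s"

definition partial_deriv :: "'n \<Rightarrow> (real ^ 'n::finite \<Rightarrow> complex) \<Rightarrow> real ^ 'n \<Rightarrow> complex" where
  "partial_deriv i f x = frechet_derivative f (at x) (axis i 1)"

text \<open>A list of coordinates plays the role of a multi-index.  Total differentiability of all
  iterated partial derivatives is smoothness.\<close>

definition schwartz :: "(real ^ 'n::finite \<Rightarrow> complex) \<Rightarrow> bool" where
  "schwartz f \<longleftrightarrow>
     (\<forall>is. (\<forall>x. foldr partial_deriv is f differentiable (at x)) \<and>
           (\<forall>k::nat. \<exists>C. \<forall>x. norm x ^ k * norm (foldr partial_deriv is f x) \<le> C))"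

definition fourier :: "(real ^ 'n::finite \<Rightarrow> complex) \<Rightarrow> real ^ 'n \<Rightarrow> complex" where
  "fourier f x = (LINT y|lborel. exp (\<i> * complex_of_real (x \<bullet> y)) * f y)"

definition zeta_integral ::
  "parity \<Rightarrow> (real ^ ('p::finite + 'q::finite) \<Rightarrow> complex) \<Rightarrow> complex \<Rightarrow> complex" where
  "zeta_integral \<epsilon> f s = (LINT x|lborel. f x * jdet_pow \<epsilon> s x)"

text \<open>The meromorphic continuation of the zeta integral.  It is unique as a function because
  \<open>nicely_meromorphic_on\<close> fixes the value 0 at poles and excludes removable singularities.\<close>

definition zeta ::
  "parity \<Rightarrow> (real ^ ('p::finite + 'q::finite) \<Rightarrow> complex) \<Rightarrow> complex \<Rightarrow> complex" where
  "zeta \<epsilon> f = (THE F. F nicely_meromorphic_on UNIV \<and>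
                    (\<forall>s. Re s > 0 \<longrightarrow> F s = zeta_integral \<epsilon> f s))"

definition gamma_factor :: "nat \<Rightarrow> complex \<Rightarrow> complex" where
  "gamma_factor n s =
     2 powr (2 * s + of_nat n) * complex_of_real (pi powr (real n / 2 - 1)) *
     Gamma (s + 1) * Gamma (s + of_nat n / 2)"

definition A_matrix :: "nat \<Rightarrow> nat \<Rightarrow> complex \<Rightarrow> complex ^ 2 ^ 2" where
  "A_matrix p q s =
    (let n = of_nat (p + q);
         \<alpha> = (of_nat p - of_nat q) * of_real pi / 4;
         \<beta> = n * of_real pi / 4;
         \<sigma> = (s + n / 4) * of_real pi
     in vector [vector [cos \<alpha> * (sin \<beta> - sin \<sigma>),   sin \<alpha> * (cos \<sigma> - cos \<beta>)],
                vector [sin \<alpha> * (cos \<sigma> + cos \<beta>), - (cos \<alpha> * (sin \<beta> + sin \<sigma>))]])"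

end

theory Submission
  imports Defs "HOL-Probability.Probability"
begin

text \<open>
  Put \<open>\<Phi>\<^sub>f(t) = \<integral> exp (i t P(x) / 2) f(x) dx\<close> for real \<open>t\<close>. The Fourier transform of complex
  Gaussians gives \<open>\<Phi>\<^sub>F(t) = (2 \<pi> / \<bar>t\<bar>)\<^bsup>n/2\<^esup> exp (i \<pi> (p - q) sgn t / 4) \<Phi>\<^sub>f(- 1 / t)\<close>, where \<open>F\<close> is
  the Fourier transform of \<open>f\<close>. As \<open>\<Phi>\<^sub>f\<close> and \<open>\<Phi>\<^sub>F\<close> have Taylor expansions at \<open>0\<close>, the Mellin
  transforms of \<open>t \<mapsto> \<Phi>\<^sub>f(t)\<close> and \<open>t \<mapsto> \<Phi>\<^sub>f(- t)\<close> continue meromorphically to the whole plane, and the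
  inversion \<open>t \<mapsto> 1 / t\<close> relates their values at \<open>u\<close> to those for \<open>F\<close> at \<open>n/2 - u\<close>. For
  \<open>0 < Re s < 1\<close> the integral
  \<open>\<integral> t\<^bsup>-s-1\<^esup> (exp (i \<theta> t) - 1) dt = \<Gamma>(-s) \<bar>\<theta>\<bar>\<^bsup>s\<^esup> exp (- i \<pi> s sgn \<theta> / 2)\<close> and Fubini's theorem express
  the Mellin transforms at \<open>u = -s\<close> linearly by the two zeta integrals at \<open>s\<close>; solving this
  system of two equations yields the functional equations. Throughout \<open>t = exp x\<close>, so that Mellin
  transforms become two-sided Laplace transforms.
\<close>

section \<open>Integrals depending on a parameter\<close>

text \<open>The two sides of the functional equation have no common half-plane of convergence: Re s
  > 0 and Re (- s - n/2) > 0 exclude each other. Mellin transforms in t bridge this gap, because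
  their continuation depends only on the behaviour of the oscillatory integral at t = 0 and at
  infinity, and the duality turns the second into the first. One Taylor expansion at 0, for f and
  for its Fourier transform, therefore yields both the continuation and the equation, and the
  singularities of powers of P along the null cone never have to be resolved. The subtraction of 1
  in the kernel is what makes the link to the zeta integrals rigorous. For real nonzero theta the
  function exp (i theta t) does not decay, and t to the power - s - 1 is not integrable at 0 when Re
  s > 0; after the subtraction the integral converges absolutely exactly for 0 < Re s < 1. This
  strip lies where the zeta integrals converge, and it is wide enough for the identity theorem. Two
  zeta integrals are unknown, so two equations are needed: one for each sign of t.\<close>

lemma tendsto_LINT_at_within:
  fixes F :: "'b::first_countable_topology \<Rightarrow> 'a \<Rightarrow> 'c::{banach, second_countable_topology}"
  assumes meas: "\<forall>\<^sub>F z in at a within S. F z \<in> borel_measurable M"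
    and bound: "\<forall>\<^sub>F z in at a within S. \<forall>x\<in>space M. norm (F z x) \<le> g x"
    and g: "integrable M g"
    and lim: "\<And>x. x \<in> space M \<Longrightarrow> ((\<lambda>z. F z x) \<longlongrightarrow> G x) (at a within S)"
  shows "((\<lambda>z. LINT x|M. F z x) \<longlongrightarrow> (LINT x|M. G x)) (at a within S)"
  unfolding tendsto_at_iff_sequentially
proof (intro allI impI)
  fix X assume X: "\<forall>i. X i \<in> S - {a}" "X \<longlonglongrightarrow> a"
  have flim: "filterlim X (at a within S) sequentially"
    using X by (auto simp: filterlim_at)
  have "\<forall>\<^sub>F i in sequentially. F (X i) \<in> borel_measurable M \<and> (\<forall>x\<in>space M. norm (F (X i) x) \<le> g x)"
    using filterlim_iff[THEN iffD1, OF flim] eventually_conj[OF meas bound] by blast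
  then obtain N where N: "\<And>i. i \<ge> N \<Longrightarrow> F (X i) \<in> borel_measurable M"
      "\<And>i x. i \<ge> N \<Longrightarrow> x \<in> space M \<Longrightarrow> norm (F (X i) x) \<le> g x"
    by (auto simp: eventually_sequentially)
  have lim': "(\<lambda>i. F (X (i + N)) x) \<longlonglongrightarrow> G x" if "x \<in> space M" for x
    using LIMSEQ_ignore_initial_segment[OF filterlim_compose[OF lim[OF that] flim], of N] by simp
  \<comment> \<open>Measurability and the bound are known only from index \<open>N\<close> on, hence
    dominated convergence for the shifted sequence.\<close>
  have "(\<lambda>i. LINT x|M. F (X (i + N)) x) \<longlonglongrightarrow> (LINT x|M. G x)"
  proof (rule integral_dominated_convergence[where w = g])
    show "G \<in> borel_measurable M"
      by (rule borel_measurable_LIMSEQ_metric[of "\<lambda>i. F (X (i + N))"]) (use N lim' in auto)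
  qed (use N lim' g in auto)
  then show "((\<lambda>z. LINT x|M. F z x) \<circ> X) \<longlonglongrightarrow> (LINT x|M. G x)"
    unfolding o_def by (rule LIMSEQ_offset)
qed

text \<open>A local majorant of \<open>F\<close> alone is enough: Cauchy's inequality on discs of
  radius r/2 turns the majorant \<open>g\<close> into the majorant 2/r * g for the derivative in the
  parameter, hence for all difference quotients, and dominated convergence applies to these.\<close>

lemma holomorphic_on_LINT:
  fixes F :: "complex \<Rightarrow> 'a \<Rightarrow> complex"
  assumes "open U"
    and meas: "\<And>z. z \<in> U \<Longrightarrow> F z \<in> borel_measurable M"
    and hol: "\<And>x. x \<in> space M \<Longrightarrow> (\<lambda>z. F z x) holomorphic_on U"
    and dom: "\<And>z0. z0 \<in> U \<Longrightarrow> \<exists>r>0. \<exists>g. integrable M g \<and> cball z0 r \<subseteq> U \<and>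
                 (\<forall>z\<in>cball z0 r. \<forall>x\<in>space M. norm (F z x) \<le> g x)"
  shows "(\<lambda>z. LINT x|M. F z x) holomorphic_on U"
proof -
  have "\<exists>D. ((\<lambda>z. LINT x|M. F z x) has_field_derivative D) (at z0)" if z0: "z0 \<in> U" for z0
  proof -
    obtain r g where r: "r > 0" "cball z0 r \<subseteq> U" and g: "integrable M g"
      and bound: "\<And>z x. z \<in> cball z0 r \<Longrightarrow> x \<in> space M \<Longrightarrow> norm (F z x) \<le> g x"
      using dom[OF z0] by blast
    have int: "integrable M (F z)" if "z \<in> cball z0 r" for z
      using that r bound by (intro Bochner_Integration.integrable_bound[OF g] meas) (auto intro!: AE_I2 order.trans[OF _ abs_ge_self])
    have quot: "norm ((F z x - F z0 x) / (z - z0)) \<le> 2 / r * g x" if z: "z \<in> ball z0 (r/2)" "z \<noteq> z0" and x: "x \<in> space M" for z x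
    proof -
      have "norm (F z x - F z0 x) \<le> (2 / r * g x) * norm (z - z0)"
      proof (rule field_differentiable_bound[where S = "ball z0 (r/2)" and f' = "deriv (\<lambda>z. F z x)"])
        fix w assume w: "w \<in> ball z0 (r/2)"
        have sub: "cball w (r/2) \<subseteq> cball z0 r"
        proof
          fix v assume "v \<in> cball w (r/2)"
          then show "v \<in> cball z0 r" using w dist_triangle[of z0 v w] by auto
        qed
        have "w \<in> U" using sub r by (auto simp: subset_iff)
        have hw: "(\<lambda>z. F z x) holomorphic_on cball w (r/2)"
          by (rule holomorphic_on_subset[OF hol[OF x]]) (use sub r in blast)
        show "((\<lambda>z. F z x) has_field_derivative deriv (\<lambda>z. F z x) w) (at w within ball z0 (r/2))"
          using holomorphic_derivI[OF hol[OF x] \<open>open U\<close> \<open>w \<in> U\<close>] by (rule has_field_derivative_at_within)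
        have "norm ((deriv ^^ 1) (\<lambda>z. F z x) w) \<le> fact 1 * g x / (r/2)^1"
        proof (rule Cauchy_inequality)
          show "(\<lambda>z. F z x) holomorphic_on ball w (r/2)"
            by (rule holomorphic_on_subset[OF hw]) auto
          show "continuous_on (cball w (r/2)) (\<lambda>z. F z x)"
            by (rule holomorphic_on_imp_continuous_on[OF hw])
          fix v assume "norm (w - v) = r/2"
          then show "norm (F v x) \<le> g x"
            using sub by (intro bound x) (auto simp: subset_iff dist_norm)
        qed (use r in auto)
        then show "norm (deriv (\<lambda>z. F z x) w) \<le> 2 / r * g x" by (simp add: field_simps)
      qed (use z r in auto)
      then show ?thesis using z r by (simp add: norm_divide divide_simps)
    qed
    have "((\<lambda>z. LINT x|M. (F z x - F z0 x) / (z - z0)) \<longlongrightarrow> (LINT x|M. deriv (\<lambda>z. F z x) z0)) (at z0)"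
    proof (rule tendsto_LINT_at_within[where g = "\<lambda>x. 2 / r * g x"])
      have ev: "\<forall>\<^sub>F z in at z0. z \<in> ball z0 (r/2) \<and> z \<noteq> z0"
        using r by (intro eventually_conj eventually_at_in_open' eventually_neq_at_within) auto
      show "\<forall>\<^sub>F z in at z0. (\<lambda>x. (F z x - F z0 x) / (z - z0)) \<in> borel_measurable M"
        using ev
      proof eventually_elim
        case (elim z)
        then have "z \<in> U" using r by (auto simp: subset_iff)
        then show ?case using meas z0 by measurable
      qed
      show "\<forall>\<^sub>F z in at z0. \<forall>x\<in>space M. norm ((F z x - F z0 x) / (z - z0)) \<le> 2 / r * g x"
        using ev by eventually_elim (use quot in auto)
      show "integrable M (\<lambda>x. 2 / r * g x)" using g by simp
      fix x assume "x \<in> space M"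
      then show "((\<lambda>z. (F z x - F z0 x) / (z - z0)) \<longlongrightarrow> deriv (\<lambda>z. F z x) z0) (at z0)"
        using holomorphic_derivI[OF hol \<open>open U\<close> z0] by (simp add: has_field_derivative_iff)
    qed
    also have "?this \<longleftrightarrow> ((\<lambda>z. ((LINT x|M. F z x) - (LINT x|M. F z0 x)) / (z - z0)) \<longlongrightarrow> (LINT x|M. deriv (\<lambda>z. F z x) z0)) (at z0)"
    proof (rule tendsto_cong)
      have "\<forall>\<^sub>F z in at z0. z \<in> ball z0 r"
        using r by (intro eventually_at_in_open') auto
      then show "\<forall>\<^sub>F z in at z0. (LINT x|M. (F z x - F z0 x) / (z - z0)) = ((LINT x|M. F z x) - (LINT x|M. F z0 x)) / (z - z0)"
        by eventually_elim (use int r in simp)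
    qed
    finally show ?thesis by (auto simp: has_field_derivative_iff)
  qed
  then show ?thesis
    using \<open>open U\<close> by (auto simp: holomorphic_on_def field_differentiable_def intro: has_field_derivative_at_within)
qed

section \<open>Exponential integrals over the negative half-line\<close>

lemma integrable_exp_half_line:
  fixes c :: real
  assumes "c > 0"
  shows "set_integrable lborel {..0} (\<lambda>x. exp (c * x))"
proof -
  have "set_integrable lborel (einterval (-\<infinity>) 0) (\<lambda>x. exp (c * x))"
  proof (rule interval_integral_FTC_nonneg(1)[where F = "\<lambda>x. exp (c * x) / c" and A = 0 and B = "1/c"])
    show "(((\<lambda>x. exp (c * x) / c) \<circ> real_of_ereal) \<longlongrightarrow> 0) (at_right (-\<infinity>))"
      unfolding ereal_tendsto_simps1 using assms by real_asymp
    show "(((\<lambda>x. exp (c * x) / c) \<circ> real_of_ereal) \<longlongrightarrow> 1 / c) (at_left 0)"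
      unfolding zero_ereal_def ereal_tendsto_simps using assms by (auto intro!: tendsto_eq_intros)
  qed (use assms in \<open>auto intro!: derivative_eq_intros continuous_intros\<close>)
  then have "set_integrable lborel {..<0} (\<lambda>x. exp (c * x))"
    by (simp add: einterval_def zero_ereal_def flip: lessThan_def)
  moreover have "AE x in lborel. indicator {..<0} x *\<^sub>R exp (c * x) = (indicator {..0} x *\<^sub>R exp (c * x) :: real)"
    using AE_lborel_singleton[of "0::real"] by eventually_elim (auto simp: indicator_def)
  ultimately show ?thesis
    unfolding set_integrable_def by (subst (asm) integrable_cong_AE) auto
qed

lemma
  fixes v :: complex
  assumes "Re v > 0"
  shows set_integrable_cexp_half_line: "set_integrable lborel {..0} (\<lambda>x. exp (v * of_real x))"
    and LINT_cexp_half_line: "(LINT x:{..0}|lborel. exp (v * of_real x)) = 1 / v"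
proof -
  show int: "set_integrable lborel {..0} (\<lambda>x. exp (v * of_real x))"
    by (rule set_integrable_bound[OF integrable_exp_half_line[OF assms]])
      (auto simp: set_borel_measurable_def)
  have "v \<noteq> 0" using assms by auto
  have "(LBINT x=-\<infinity>..0. exp (v * of_real x)) = 1/v - 0"
  proof (rule interval_integral_FTC_integrable[where F = "\<lambda>x. exp (v * of_real x) / v"])
    show "((\<lambda>x. exp (v * of_real x) / v) has_vector_derivative exp (v * of_real x)) (at x)" for x
      by (rule has_vector_derivative_real_field) (use \<open>v \<noteq> 0\<close> in \<open>auto intro!: derivative_eq_intros\<close>)
    show "set_integrable lborel (einterval (-\<infinity>) 0) (\<lambda>x. exp (v * of_real x))"
      by (rule set_integrable_subset[OF int]) (auto simp: einterval_def zero_ereal_def)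
    have "((\<lambda>x. exp (Re v * x) / norm v) \<longlongrightarrow> 0) at_bot"
    proof -
      have "((\<lambda>x. exp (c * x)) \<longlongrightarrow> 0) at_bot" if "c > 0" for c :: real
        using that by real_asymp
      from tendsto_mult_left_zero[OF this[OF assms], of "inverse (norm v)"]
      show ?thesis by (simp add: divide_inverse)
    qed
    then have "((\<lambda>x. exp (v * of_real x) / v) \<longlongrightarrow> 0) at_bot"
      by - (rule tendsto_norm_zero_cancel, simp add: norm_divide)
    then show "(((\<lambda>x. exp (v * of_real x) / v) \<circ> real_of_ereal) \<longlongrightarrow> 0) (at_right (-\<infinity>))"
      unfolding ereal_tendsto_simps1 .
    show "(((\<lambda>x. exp (v * of_real x) / v) \<circ> real_of_ereal) \<longlongrightarrow> 1 / v) (at_left 0)"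
      unfolding zero_ereal_def ereal_tendsto_simps by (auto intro!: tendsto_eq_intros simp: \<open>v \<noteq> 0\<close>)
  qed auto
  also have "(LBINT x=-\<infinity>..0. exp (v * of_real x)) = (LINT x:{..<0}|lborel. exp (v * of_real x))"
    by (simp add: interval_lebesgue_integral_def einterval_def zero_ereal_def flip: lessThan_def)
  also have "\<dots> = (LINT x:{..0}|lborel. exp (v * of_real x))"
    unfolding set_lebesgue_integral_def
  proof (rule integral_cong_AE)
    show "AE x in lborel. indicator {..<0} x *\<^sub>R exp (v * of_real x) = indicator {..0} x *\<^sub>R exp (v * of_real x)"
      using AE_lborel_singleton[of "0::real"] by eventually_elim (auto simp: indicator_def)
  qed auto
  finally show "(LINT x:{..0}|lborel. exp (v * of_real x)) = 1 / v" by simp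
qed

section \<open>Continuation of a one-sided Laplace transform\<close>

text \<open>In the variable t = exp x this is an asymptotic power series at t = 0, with remainder
  O(t^N) on the whole interval 0 < t <= 1 for every N; the series itself may diverge.\<close>

definition expands_at_minus_infinity :: "(real \<Rightarrow> complex) \<Rightarrow> (nat \<Rightarrow> complex) \<Rightarrow> bool" where
  "expands_at_minus_infinity g a \<longleftrightarrow> g \<in> borel_measurable borel \<and>
     (\<forall>N. \<exists>C. \<forall>x\<le>0. norm (g x - (\<Sum>k<N. a k * exp (of_nat k * of_real x))) \<le> C * exp (real N * x))"

text \<open>The remainder after \<open>N\<close> terms is of order exp (N x), so the integral
  converges absolutely for Re u > - N.\<close>

definition laplace_tail :: "(real \<Rightarrow> complex) \<Rightarrow> (nat \<Rightarrow> complex) \<Rightarrow> nat \<Rightarrow> complex \<Rightarrow> complex" where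
  "laplace_tail g a N u =
     (LINT x:{..0}|lborel. exp (u * of_real x) * (g x - (\<Sum>k<N. a k * exp (of_nat k * of_real x))))"

text \<open>The subtracted terms \<open>a k * exp (k x)\<close> are integrated exactly, which produces the poles.\<close>

definition laplace_trunc :: "(real \<Rightarrow> complex) \<Rightarrow> (nat \<Rightarrow> complex) \<Rightarrow> nat \<Rightarrow> complex \<Rightarrow> complex" where
  "laplace_trunc g a N u = (\<Sum>k<N. a k / (u + of_nat k)) + laplace_tail g a N u"

text \<open>The truncation order is the least one for which \<open>laplace_tail\<close> surely converges at \<open>u\<close>; by
  \<open>laplace_trunc_Suc\<close> a larger one gives the same value.\<close>

definition laplace_cont :: "(real \<Rightarrow> complex) \<Rightarrow> (nat \<Rightarrow> complex) \<Rightarrow> complex \<Rightarrow> complex" where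
  "laplace_cont g a u = laplace_trunc g a (nat (\<lceil>- Re u\<rceil> + 1)) u"

context
  fixes g :: "real \<Rightarrow> complex" and a :: "nat \<Rightarrow> complex"
  assumes ex: "expands_at_minus_infinity g a"
begin

lemma expands_meas [measurable]: "g \<in> borel_measurable borel"
  using ex by (simp add: expands_at_minus_infinity_def)

text \<open>The constant does not depend on u, so that one majorant serves a whole disc of
  parameters in \<open>laplace_tail_holomorphic\<close>.\<close>

lemma laplace_tail_bound:
  "\<exists>C\<ge>0. \<forall>u. \<forall>x\<le>0. norm (exp (u * of_real x) * (g x - (\<Sum>k<N. a k * exp (of_nat k * of_real x))))
     \<le> C * exp ((Re u + real N) * x)"
proof -
  obtain C where C: "\<And>x. x \<le> 0 \<Longrightarrow> norm (g x - (\<Sum>k<N. a k * exp (of_nat k * of_real x))) \<le> C * exp (real N * x)"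
    using ex unfolding expands_at_minus_infinity_def by blast
  have "norm (exp (u * of_real x) * (g x - (\<Sum>k<N. a k * exp (of_nat k * of_real x)))) \<le> C * exp ((Re u + real N) * x)"
    if "x \<le> 0" for u x
    using mult_left_mono[OF C[OF that], of "exp (Re u * x)"]
    by (simp add: norm_mult exp_add distrib_left mult_ac)
  moreover have "C \<ge> 0" using order.trans[OF norm_ge_zero C[of 0]] by simp
  ultimately show ?thesis by blast
qed

lemma set_integrable_laplace_tail:
  assumes "Re u > - real N"
  shows "set_integrable lborel {..0} (\<lambda>x. exp (u * of_real x) * (g x - (\<Sum>k<N. a k * exp (of_nat k * of_real x))))"
proof -
  obtain C where C: "\<And>x. x \<le> 0 \<Longrightarrow> norm (exp (u * of_real x) * (g x - (\<Sum>k<N. a k * exp (of_nat k * of_real x))))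
     \<le> C * exp ((Re u + real N) * x)"
    using laplace_tail_bound[of N] by blast
  show ?thesis
  proof (rule set_integrable_bound)
    show "set_integrable lborel {..0} (\<lambda>x. C * exp ((Re u + real N) * x))"
      using assms by (intro set_integrable_mult_right integrable_exp_half_line) auto
    show "set_borel_measurable lborel {..0} (\<lambda>x. exp (u * of_real x) * (g x - (\<Sum>k<N. a k * exp (of_nat k * of_real x))))"
      unfolding set_borel_measurable_def by measurable
    show "AE x in lborel. x \<in> {..0} \<longrightarrow> norm (exp (u * of_real x) * (g x - (\<Sum>k<N. a k * exp (of_nat k * of_real x))))
       \<le> norm (C * exp ((Re u + real N) * x))"
      using C by (auto intro: order.trans[OF _ abs_ge_self])
  qed
qed

text \<open>For Re u > - N the term \<open>a N * exp ((u + N) x)\<close> is integrable over the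
  half-line with integral \<open>a N / (u + N)\<close>: what leaves the tail enters the sum.\<close>

lemma laplace_trunc_Suc:
  assumes "Re u > - real N"
  shows "laplace_trunc g a (Suc N) u = laplace_trunc g a N u"
proof -
  have nz: "Re (u + of_nat N) > 0" using assms by simp
  have i1: "set_integrable lborel {..0} (\<lambda>x. exp (u * of_real x) * (g x - (\<Sum>k<N. a k * exp (of_nat k * of_real x))))"
    by (rule set_integrable_laplace_tail[OF assms])
  have i2: "set_integrable lborel {..0} (\<lambda>x. a N * exp ((u + of_nat N) * of_real x))"
    by (intro set_integrable_mult_right set_integrable_cexp_half_line nz)
  have "laplace_tail g a (Suc N) u = (LINT x:{..0}|lborel. exp (u * of_real x) * (g x - (\<Sum>k<N. a k * exp (of_nat k * of_real x)))
         - a N * exp ((u + of_nat N) * of_real x))"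
    unfolding laplace_tail_def by (intro arg_cong[where f = "set_lebesgue_integral lborel {..0}"])
       (auto simp: fun_eq_iff algebra_simps exp_add)
  also have "\<dots> = laplace_tail g a N u - a N / (u + of_nat N)"
    unfolding laplace_tail_def using i1 i2 LINT_cexp_half_line[OF nz]
    by (subst set_integral_diff) auto
  finally show ?thesis by (simp add: laplace_trunc_def)
qed

lemma laplace_cont_eq_trunc:
  assumes "Re u > - real N"
  shows "laplace_cont g a u = laplace_trunc g a N u"
proof -
  have mono: "laplace_trunc g a (M + k) u = laplace_trunc g a M u" if "Re u > - real M" for M k
  proof (induction k)
    case (Suc k)
    then show ?case using laplace_trunc_Suc[of "M + k" u] that by simp
  qed simp
  \<comment> \<open>The \<open>+ 1\<close> in \<open>laplace_cont\<close> makes this strict also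
    when Re u is a nonpositive integer.\<close>
  have "Re u > - real (nat (\<lceil>- Re u\<rceil> + 1))" by linarith
  then show ?thesis
    using mono[of N] mono[of "nat (\<lceil>- Re u\<rceil> + 1)"] assms
    unfolding laplace_cont_def by (metis add.commute le_add_diff_inverse nle_le)
qed

lemma laplace_tail_holomorphic: "laplace_tail g a N holomorphic_on {u. Re u > - real N}"
  unfolding laplace_tail_def set_lebesgue_integral_def
proof (rule holomorphic_on_LINT)
  show "open {u. Re u > - real N}" by (rule open_halfspace_Re_gt)
  show "(\<lambda>x. indicator {..0} x *\<^sub>R (exp (u * of_real x) * (g x - (\<Sum>k<N. a k * exp (of_nat k * of_real x))))) \<in> borel_measurable lborel" for u
    by measurable
  show "(\<lambda>u. indicator {..0} x *\<^sub>R (exp (u * of_real x) * (g x - (\<Sum>k<N. a k * exp (of_nat k * of_real x))))) holomorphic_on {u. Re u > - real N}" for x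
    unfolding scaleR_conv_of_real by (intro holomorphic_intros)
  fix z0 assume "z0 \<in> {u. Re u > - real N}"
  then have z0: "Re z0 > - real N" by simp
  \<comment> \<open>Half the distance from \<open>z0\<close> to the line Re u = - N. On the closed
    disc of radius \<open>c\<close> the quantity Re u + N is still at least \<open>c\<close>, so exp
    (c x) dominates for x <= 0.\<close>
  define c where "c = (Re z0 + real N) / 2"
  have c: "c > 0" using z0 by (simp add: c_def)
  obtain C where C: "C \<ge> 0" "\<And>u x. x \<le> 0 \<Longrightarrow> norm (exp (u * of_real x) * (g x - (\<Sum>k<N. a k * exp (of_nat k * of_real x))))
     \<le> C * exp ((Re u + real N) * x)"
    using laplace_tail_bound[of N] by blast
  have Re: "Re z + real N \<ge> c" if "z \<in> cball z0 c" for z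
    using that abs_Re_le_cmod[of "z0 - z"] by (auto simp: dist_norm c_def abs_le_iff field_simps)
  show "\<exists>r>0. \<exists>h. integrable lborel h \<and> cball z0 r \<subseteq> {u. Re u > - real N} \<and>
          (\<forall>u\<in>cball z0 r. \<forall>x\<in>space lborel. norm (indicator {..0} x *\<^sub>R (exp (u * of_real x) * (g x - (\<Sum>k<N. a k * exp (of_nat k * of_real x))))) \<le> h x)"
  proof (intro exI conjI ballI)
    show "c > 0" by fact
    show "integrable lborel (\<lambda>x. C * (indicator {..0} x *\<^sub>R exp (c * x)))"
      using integrable_exp_half_line[OF c] by (simp add: set_integrable_def)
    show "cball z0 c \<subseteq> {u. Re u > - real N}"
      using Re c by fastforce
    fix u x assume u: "u \<in> cball z0 c"
    show "norm (indicator {..0} x *\<^sub>R (exp (u * of_real x) * (g x - (\<Sum>k<N. a k * exp (of_nat k * of_real x))))) \<le> C * (indicator {..0} x *\<^sub>R exp (c * x))"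
    proof (cases "x \<le> 0")
      case True
      have "(Re u + real N) * x \<le> c * x"
        using Re[OF u] True by (intro mult_right_mono_neg)
      then have "C * exp ((Re u + real N) * x) \<le> C * exp (c * x)"
        using C(1) by (intro mult_left_mono) auto
      with C(2)[OF True, of u] True show ?thesis by simp
    qed simp
  qed
qed

text \<open>The truncation order in \<open>laplace_cont\<close> jumps with u. Around each point a
  single order \<open>N\<close> can be kept fixed, and there the function is a finite sum of simple
  fractions plus a holomorphic tail.\<close>

lemma laplace_cont_meromorphic: "laplace_cont g a meromorphic_on UNIV"
proof (subst meromorphic_on_meromorphic_at, intro ballI)
  fix u :: complex
  define N where "N = nat (\<lceil>- Re u\<rceil> + 1)"
  have N: "Re u > - real N" unfolding N_def by linarith
  have op: "open {u. Re u > - real N}" by (rule open_halfspace_Re_gt)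
  have "laplace_tail g a N analytic_on {u. Re u > - real N}"
    using laplace_tail_holomorphic op by (simp add: analytic_on_open)
  then have "laplace_tail g a N meromorphic_on {u}"
    using N by (intro analytic_on_imp_meromorphic_on) (auto elim: analytic_on_subset)
  then have "laplace_trunc g a N meromorphic_on {u}"
    unfolding laplace_trunc_def
    by (intro meromorphic_on_add meromorphic_on_sum meromorphic_on_divide meromorphic_on_const meromorphic_on_id)
  also have "?this \<longleftrightarrow> laplace_cont g a meromorphic_on {u}"
  proof (rule meromorphic_on_cong)
    have "\<forall>\<^sub>F z in at u. z \<in> {u. Re u > - real N}"
      using op N by (intro eventually_at_in_open') auto
    then show "\<forall>\<^sub>F z in at w. laplace_trunc g a N z = laplace_cont g a z" if "w \<in> {u}" for w
      using that by (auto elim!: eventually_mono simp: laplace_cont_eq_trunc)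
  qed auto
  finally show "laplace_cont g a meromorphic_on {u}" .
qed

end

section \<open>Fourier transforms of complex Gaussians\<close>

text \<open>This carries integral formulas from real a > 0, where rescaling the variable of
  integration proves them, to complex a, where no such substitution exists. The positive reals
  accumulate at 1, which suffices for the identity theorem.\<close>

lemma right_half_plane_identity:
  assumes "f holomorphic_on {z. Re z > 0}" "g holomorphic_on {z. Re z > 0}"
    and eq: "\<And>a::real. a > 0 \<Longrightarrow> f (of_real a) = g (of_real a)" and "Re z > 0"
  shows "f z = g z"
proof -
  have "f z - g z = 0"
  proof (rule analytic_continuation[where f = "\<lambda>z. f z - g z" and U = "of_real ` {0<..}" and \<xi> = 1])
    show "connected {z. Re z > 0}"
      by (intro convex_connected convex_halfspace_Re_gt)
    show "1 islimpt complex_of_real ` {0<..}"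
      unfolding islimpt_approachable
    proof (intro allI impI)
      fix e :: real assume "e > 0"
      then have "complex_of_real (1 + e/2) \<in> complex_of_real ` {0<..}" by (intro imageI) auto
      then show "\<exists>x'\<in>complex_of_real ` {0<..}. x' \<noteq> 1 \<and> dist x' 1 < e"
        by (rule bexI[rotated]) (use \<open>e > 0\<close> in \<open>auto simp: dist_norm\<close>)
    qed
  qed (use assms in \<open>auto intro!: holomorphic_intros open_halfspace_Re_gt\<close>)
  then show ?thesis by simp
qed

lemma integrable_gaussian:
  fixes a :: real
  assumes "a > 0"
  shows "integrable lborel (\<lambda>y. exp (- a * y\<^sup>2))"
proof -
  have "integrable lborel (\<lambda>y. sqrt (pi / a) * normal_density 0 (sqrt (1 / (2 * a))) y)"
    using assms by (intro integrable_mult_right integrable_normal_density) auto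
  also have "(\<lambda>y. sqrt (pi / a) * normal_density 0 (sqrt (1 / (2 * a))) y) = (\<lambda>y. exp (- a * y\<^sup>2))"
    using assms by (auto simp: normal_density_def fun_eq_iff real_sqrt_divide field_simps)
  finally show ?thesis .
qed

text \<open>Rescaling by 1 / sqrt (2 a) turns the integral into the characteristic function of the
  standard normal distribution.\<close>

lemma gaussian_fourier_real:
  fixes a x :: real
  assumes "a > 0"
  shows "(LINT y|lborel. exp (\<i> * of_real (x * y) - of_real a * of_real (y\<^sup>2))) =
           of_real (sqrt pi) / csqrt (of_real a) * exp (- (of_real x)\<^sup>2 / (4 * of_real a))"
proof -
  define c where "c = 1 / sqrt (2 * a)"
  have c: "c > 0" "a * c\<^sup>2 = 1/2" using assms by (auto simp: c_def power_divide)
  have "(LINT y|lborel. exp (\<i> * of_real (x * y) - of_real a * of_real (y\<^sup>2))) =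
      \<bar>c\<bar> *\<^sub>R (LINT y|lborel. exp (\<i> * of_real (x * (0 + c * y)) - of_real a * of_real ((0 + c * y)\<^sup>2)))"
    using c by (intro lborel_integral_real_affine) auto
  also have "\<dots> = c *\<^sub>R (LINT y|lborel. sqrt (2 * pi) *\<^sub>R (std_normal_density y *\<^sub>R iexp (x * c * y)))"
  proof -
    have "exp (\<i> * of_real (x * (0 + c * y)) - of_real a * of_real ((0 + c * y)\<^sup>2)) =
       sqrt (2 * pi) *\<^sub>R (std_normal_density y *\<^sub>R iexp (x * c * y))" for y
    proof -
      have "a * (c * y)\<^sup>2 = y\<^sup>2 / 2" using c by (simp add: power_mult_distrib)
      then have eq: "of_real a * of_real ((0 + c * y)\<^sup>2) = complex_of_real (y\<^sup>2 / 2)"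
        by (metis add_0 of_real_mult)
      have "exp (z - of_real (y\<^sup>2 / 2)) = exp z * complex_of_real (exp (- y\<^sup>2 / 2))" for z
        by (simp only: diff_conv_add_uminus exp_add of_real_minus[symmetric] minus_divide_left exp_of_real[symmetric])
      then show ?thesis
        unfolding eq by (simp add: std_normal_density_def scaleR_conv_of_real mult_ac)
    qed
    then show ?thesis using c by simp
  qed
  also have "\<dots> = (c * sqrt (2 * pi)) *\<^sub>R char std_normal_distribution (x * c)"
    unfolding char_def by (subst integral_density) (auto simp: normal_density_nonneg simp flip: scaleR_scaleR)
  also have "\<dots> = of_real (c * sqrt (2 * pi)) * exp (- (of_real (x * c))\<^sup>2 / 2)"
    by (simp add: char_std_normal_distribution scaleR_conv_of_real flip: exp_of_real)
  also have "c * sqrt (2 * pi) = sqrt pi / sqrt a"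
    by (simp add: c_def real_sqrt_mult)
  also have "(x * c)\<^sup>2 / 2 = x\<^sup>2 / (4 * a)"
    using c assms by (simp add: c_def power_mult_distrib power_divide)
  then have "- (of_real (x * c))\<^sup>2 / 2 = - (complex_of_real x)\<^sup>2 / (4 * of_real a)"
    by (metis (no_types) minus_divide_left of_real_divide of_real_mult of_real_numeral of_real_power)
  finally show ?thesis using assms by (simp add: csqrt_of_real_nonneg)
qed

lemma integrable_complex_gaussian:
  fixes x :: real
  assumes "Re a > 0"
  shows "integrable lborel (\<lambda>y. exp (\<i> * of_real (x * y) - a * of_real (y\<^sup>2)))"
  by (rule Bochner_Integration.integrable_bound[OF integrable_gaussian[OF assms]]) auto

text \<open>Both sides are holomorphic in \<open>a\<close>: the integral by domination with a real
  Gaussian, the right side because the cut of \<open>csqrt\<close> avoids the right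
  half-plane.\<close>

lemma gaussian_fourier:
  fixes x :: real
  assumes "Re a > 0"
  shows "(LINT y|lborel. exp (\<i> * of_real (x * y) - a * of_real (y\<^sup>2))) =
           of_real (sqrt pi) / csqrt a * exp (- (of_real x)\<^sup>2 / (4 * a))"
proof (rule right_half_plane_identity[where z = a])
  show "(\<lambda>a. of_real (sqrt pi) / csqrt a * exp (- (of_real x)\<^sup>2 / (4 * a))) holomorphic_on {z. Re z > 0}"
    by (intro holomorphic_intros) (auto simp: complex_nonpos_Reals_iff)
  show "(\<lambda>a. LINT y|lborel. exp (\<i> * of_real (x * y) - a * of_real (y\<^sup>2))) holomorphic_on {z. Re z > 0}"
  proof (rule holomorphic_on_LINT)
    fix z0 assume "z0 \<in> {z. Re z > 0}"
    then have z0: "Re z0 > 0" by simp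
    define r where "r = Re z0 / 2"
    have r: "r > 0" using z0 by (simp add: r_def)
    have Re: "Re z \<ge> r" if "z \<in> cball z0 r" for z
      using that abs_Re_le_cmod[of "z0 - z"] by (auto simp: dist_norm r_def abs_le_iff)
    show "\<exists>r>0. \<exists>g. integrable lborel g \<and> cball z0 r \<subseteq> {z. Re z > 0} \<and>
      (\<forall>z\<in>cball z0 r. \<forall>y\<in>space lborel. norm (exp (\<i> * of_real (x * y) - z * of_real (y\<^sup>2))) \<le> g y)"
    proof (intro exI conjI ballI)
      show "integrable lborel (\<lambda>y. exp (- r * y\<^sup>2))" by (rule integrable_gaussian[OF r])
      show "cball z0 r \<subseteq> {z. Re z > 0}" using Re r by fastforce
      fix z y assume "z \<in> cball z0 r"
      then show "norm (exp (\<i> * of_real (x * y) - z * of_real (y\<^sup>2))) \<le> exp (- r * y\<^sup>2)"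
        using mult_right_mono[OF Re, of z "y\<^sup>2"] by simp
    qed (rule r)
  qed (auto intro!: holomorphic_intros open_halfspace_Re_gt)
  fix a :: real assume "a > 0"
  then show "(LINT y|lborel. exp (\<i> * of_real (x * y) - of_real a * of_real (y\<^sup>2))) =
      of_real (sqrt pi) / csqrt (of_real a) * exp (- (of_real x)\<^sup>2 / (4 * of_real a))"
    by (rule gaussian_fourier_real)
qed (rule assms)

text \<open>As an image of a product measure, \<open>lborel\<close> on a vector space is indexed by
  \<open>Basis\<close>, while the product in the statement is indexed by coordinates; the bijection
  \<open>e\<close> onto \<open>Basis\<close> translates between the two.\<close>

lemma
  fixes h :: "'n::finite \<Rightarrow> real \<Rightarrow> 'a::{real_normed_field, banach, second_countable_topology}"
  assumes int: "\<And>i. integrable lborel (h i)"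
  shows integrable_lborel_vec_prod: "integrable lborel (\<lambda>x::real^'n. \<Prod>i\<in>UNIV. h i (x $ i))"
    and LINT_lborel_vec_prod: "(LINT x|lborel. (\<Prod>i\<in>UNIV. h i ((x::real^'n) $ i))) = (\<Prod>i\<in>UNIV. (LINT y|lborel. h i y))"
proof -
  interpret product_sigma_finite "\<lambda>_::real^'n. lborel :: real measure"
    by standard
  define e :: "'n \<Rightarrow> real^'n" where "e i = axis i 1" for i
  have inj: "inj e" by (auto simp: inj_def e_def axis_eq_axis)
  have B: "Basis = range e" by (auto simp: Basis_vec_def e_def)
  define h' where "h' b = h (inv e b)" for b
  define T where "T w = (\<Sum>b\<in>Basis. w b *\<^sub>R b)" for w :: "real^'n \<Rightarrow> real"
  have T[measurable]: "T \<in> (\<Pi>\<^sub>M b\<in>Basis. lborel) \<rightarrow>\<^sub>M borel"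
    unfolding T_def by measurable
  have Tc: "T w $ i = w (e i)" for w i
    using inner_sum_left_Basis[of "e i" w] by (simp add: T_def e_def cart_eq_inner_axis axis_in_Basis_iff)
  have prod: "(\<Prod>i\<in>UNIV. h i (T w $ i)) = (\<Prod>b\<in>Basis. h' b (w b))" for w
    by (simp add: B prod.reindex inj h'_def Tc)
  have [measurable]: "h i \<in> borel_measurable borel" for i
    using borel_measurable_integrable[OF int[of i]] by simp
  have meas: "(\<lambda>x::real^'n. \<Prod>i\<in>UNIV. h i (x $ i)) \<in> borel_measurable borel"
    by (intro borel_measurable_prod) measurable
  have l: "(lborel :: (real^'n) measure) = distr (\<Pi>\<^sub>M b\<in>Basis. lborel) borel T"
    by (subst lborel_eq) (simp add: T_def[abs_def])
  have inth: "integrable lborel (h' b)" for b by (simp add: h'_def int)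
  show "integrable lborel (\<lambda>x::real^'n. \<Prod>i\<in>UNIV. h i (x $ i))"
    unfolding l by (subst integrable_distr_eq[OF T meas], unfold prod)
      (intro product_integrable_prod inth finite_Basis)
  have "(LINT x|lborel. (\<Prod>i\<in>UNIV. h i ((x::real^'n) $ i))) = (\<Prod>b\<in>Basis. (LINT y|lborel. h' b y))"
    unfolding l by (subst integral_distr[OF T meas], unfold prod)
      (intro product_integral_prod inth finite_Basis)
  also have "\<dots> = (\<Prod>i\<in>UNIV. (LINT y|lborel. h i y))"
    by (simp add: B prod.reindex inj h'_def)
  finally show "(LINT x|lborel. (\<Prod>i\<in>UNIV. h i ((x::real^'n) $ i))) = (\<Prod>i\<in>UNIV. (LINT y|lborel. h i y))" .
qed

lemma
  fixes c :: "'n::finite \<Rightarrow> complex" and x :: "real^'n"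
  assumes c: "\<And>i. Re (c i) > 0"
  shows integrable_gaussian_vec:
      "integrable lborel (\<lambda>y. exp (\<i> * of_real (x \<bullet> y) - (\<Sum>i\<in>UNIV. c i * of_real ((y $ i)\<^sup>2))))"
    and gaussian_fourier_vec:
      "(LINT y|lborel. exp (\<i> * of_real (x \<bullet> y) - (\<Sum>i\<in>UNIV. c i * of_real ((y $ i)\<^sup>2)))) =
        (\<Prod>i\<in>UNIV. of_real (sqrt pi) / csqrt (c i)) * exp (- (\<Sum>i\<in>UNIV. of_real ((x $ i)\<^sup>2) / (4 * c i)))"
proof -
  have split: "exp (\<i> * of_real (x \<bullet> y) - (\<Sum>i\<in>UNIV. c i * of_real ((y $ i)\<^sup>2))) =
     (\<Prod>i\<in>UNIV. exp (\<i> * of_real (x $ i * y $ i) - c i * of_real ((y $ i)\<^sup>2)))" for y :: "real^'n"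
    by (simp add: inner_vec_def sum_subtractf sum_distrib_left flip: exp_sum)
  note int = integrable_complex_gaussian[OF c]
  show "integrable lborel (\<lambda>y. exp (\<i> * of_real (x \<bullet> y) - (\<Sum>i\<in>UNIV. c i * of_real ((y $ i)\<^sup>2))))"
    unfolding split by (rule integrable_lborel_vec_prod[OF int])
  have "(LINT y|lborel. exp (\<i> * of_real (x \<bullet> y) - (\<Sum>i\<in>UNIV. c i * of_real ((y $ i)\<^sup>2)))) =
      (\<Prod>i\<in>UNIV. (LINT y|lborel. exp (\<i> * of_real (x $ i * y) - c i * of_real (y\<^sup>2))))"
    unfolding split by (rule LINT_lborel_vec_prod[OF int])
  also have "\<dots> = (\<Prod>i\<in>UNIV. of_real (sqrt pi) / csqrt (c i) * exp (- (of_real (x $ i))\<^sup>2 / (4 * c i)))"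
    by (intro prod.cong refl gaussian_fourier c)
  also have "\<dots> = (\<Prod>i\<in>UNIV. of_real (sqrt pi) / csqrt (c i)) * exp (- (\<Sum>i\<in>UNIV. of_real ((x $ i)\<^sup>2) / (4 * c i)))"
    unfolding prod.distrib by (simp add: exp_sum flip: sum_negf)
  finally show "(LINT y|lborel. exp (\<i> * of_real (x \<bullet> y) - (\<Sum>i\<in>UNIV. c i * of_real ((y $ i)\<^sup>2)))) =
        (\<Prod>i\<in>UNIV. of_real (sqrt pi) / csqrt (c i)) * exp (- (\<Sum>i\<in>UNIV. of_real ((x $ i)\<^sup>2) / (4 * c i)))" .
qed

section \<open>The Gamma function as a Mellin transform of oscillating exponentials\<close>

text \<open>\<open>absolutely_integrable_on\<close> refers to the completion of
  \<open>lborel\<close>; for Borel measurable functions both measures give the same integrable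
  functions. This brings Euler's integral for \<open>Gamma\<close> to \<open>lborel\<close>.\<close>

lemma absolutely_integrable_imp_lborel:
  fixes f :: "'a::euclidean_space \<Rightarrow> 'b::euclidean_space"
  assumes "f absolutely_integrable_on S" "set_borel_measurable lborel S f"
  shows "set_integrable lborel S f"
  using assms unfolding set_integrable_def set_borel_measurable_def
  by (simp add: integrable_completion)

text \<open>The common majorant of all kernels below. With t = exp x it is t to the power - \<sigma>
  times min 2 t, with respect to dt/t: the factor t at 0 requires \<sigma> < 1, the constant 2 at
  infinity requires \<sigma> > 0.\<close>

lemma integrable_exp_min:
  fixes \<sigma> :: real
  assumes "0 < \<sigma>" "\<sigma> < 1"
  shows "integrable lborel (\<lambda>x. exp (- \<sigma> * x) * min 2 (exp x))"
proof (rule Bochner_Integration.integrable_bound)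
  have "integrable lborel (\<lambda>x. indicator {..0} x *\<^sub>R exp ((1 - \<sigma>) * x))"
    using integrable_exp_half_line[of "1 - \<sigma>"] assms by (simp add: set_integrable_def)
  moreover have "integrable lborel (\<lambda>x. indicator {..0} (0 + (-1) * x) *\<^sub>R exp (\<sigma> * (0 + (-1) * x)))"
    using integrable_exp_half_line[of \<sigma>] assms
    by (intro lborel_integrable_real_affine) (simp_all add: set_integrable_def)
  ultimately show "integrable lborel (\<lambda>x. indicator {..0} x *\<^sub>R exp ((1 - \<sigma>) * x)
      + 2 * (indicator {..0} (0 + (-1) * x) *\<^sub>R exp (\<sigma> * (0 + (-1) * x))))"
    by (intro Bochner_Integration.integrable_add integrable_mult_right)
  have "exp (- \<sigma> * x) * min 2 (exp x) \<le> indicator {..0} x * exp ((1 - \<sigma>) * x)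
      + 2 * (indicator {..0} (- x) * exp (- \<sigma> * x))" for x
  proof (cases "x \<le> 0")
    case True
    have "exp (- \<sigma> * x) * min 2 (exp x) \<le> exp (- \<sigma> * x) * exp x" by (intro mult_left_mono) auto
    also have "\<dots> = exp ((1 - \<sigma>) * x)" by (simp add: algebra_simps flip: exp_add)
    finally show ?thesis using True by (simp add: indicator_def)
  next
    case False
    have "exp (- \<sigma> * x) * min 2 (exp x) \<le> exp (- \<sigma> * x) * 2" by (intro mult_left_mono) auto
    then show ?thesis using False by (simp add: indicator_def)
  qed
  then show "AE x in lborel. norm (exp (- \<sigma> * x) * min 2 (exp x)) \<le>
     norm (indicator {..0} x *\<^sub>R exp ((1 - \<sigma>) * x) + 2 * (indicator {..0} (0 + (-1) * x) *\<^sub>R exp (\<sigma> * (0 + (-1) * x))))"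
    by (intro AE_I2) (auto intro: order.trans[OF _ abs_ge_self])
qed auto

lemma norm_exp_minus_1_le:
  fixes w :: complex
  assumes "Re w \<le> 0"
  shows "norm (exp w - 1) \<le> min 2 (norm w)"
proof -
  have "norm (exp w - exp 0) \<le> 1 * norm (w - 0)"
  proof (rule field_differentiable_bound[where S = "{z. Re z \<le> 0}" and f' = exp])
    show "convex {z. Re z \<le> 0}" by (rule convex_halfspace_Re_le)
  qed (use assms in \<open>auto intro!: derivative_eq_intros\<close>)
  moreover have "norm (exp w - 1) \<le> norm (exp w) + 1"
    using norm_triangle_ineq4[of "exp w" 1] by simp
  ultimately show ?thesis using assms by (auto intro: order.trans)
qed

text \<open>The boundary case Re a = 0 is included because the oscillatory kernels live there
  (\<open>osc_mellin\<close>), and the constant is locally bounded in \<open>a\<close>, as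
  domination in the parameter requires.\<close>

lemma norm_exp_exp_bound:
  fixes a :: complex and x :: real
  assumes "Re a \<ge> 0"
  shows "norm (exp (- s * of_real x) * (exp (- a * of_real (exp x)) - 1)) \<le>
           max 1 (norm a) * (exp (- Re s * x) * min 2 (exp x))"
proof -
  have "norm (exp (- a * of_real (exp x)) - 1) \<le> min 2 (norm a * exp x)"
    using norm_exp_minus_1_le[of "- a * of_real (exp x)"] assms by (simp add: norm_mult)
  also have "\<dots> \<le> max 1 (norm a) * min 2 (exp x)"
  proof (cases "exp x \<le> 2")
    case True
    then show ?thesis by (auto simp: min_def intro!: order.trans[OF _ mult_right_mono[of "norm a"]])
  next
    case False
    then show ?thesis by (auto simp: min_def)
  qed
  finally show ?thesis
    by (simp add: norm_mult mult_ac mult_left_mono)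
qed

lemma integrable_exp_exp:
  fixes a s :: complex
  assumes "0 < Re s" "Re s < 1" "Re a \<ge> 0"
  shows "integrable lborel (\<lambda>x. exp (- s * of_real x) * (exp (- a * of_real (exp x)) - 1))"
proof (rule Bochner_Integration.integrable_bound)
  show "integrable lborel (\<lambda>x. max 1 (norm a) * (exp (- Re s * x) * min 2 (exp x)))"
    by (intro integrable_mult_right integrable_exp_min assms)
qed (use norm_exp_exp_bound[OF assms(3)] in \<open>auto intro!: AE_I2 order.trans[OF _ abs_ge_self]\<close>)

text \<open>Euler's integral after the substitution t = exp x.\<close>

lemma
  assumes "Re z > 0"
  shows integrable_Gamma_exp: "integrable lborel (\<lambda>x. exp (z * of_real x - of_real (exp x)))"
    and LINT_Gamma_exp: "(LINT x|lborel. exp (z * of_real x - of_real (exp x))) = Gamma z"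
proof -
  define c where "c = Re z"
  have c: "c > 0" using assms by (simp add: c_def)
  show int: "integrable lborel (\<lambda>x. exp (z * of_real x - of_real (exp x)))"
  proof (rule Bochner_Integration.integrable_bound)
    show "integrable lborel (\<lambda>x. indicator {..0} x *\<^sub>R exp (c * x) + exp (c\<^sup>2) * exp (- (1/4) * x\<^sup>2))"
      using integrable_exp_half_line[OF c] integrable_gaussian[of "1/4"]
      by (intro Bochner_Integration.integrable_add integrable_mult_right) (simp_all add: set_integrable_def)
    have "exp (c * x - exp x) \<le> indicator {..0} x *\<^sub>R exp (c * x) + exp (c\<^sup>2) * exp (- (1/4) * x\<^sup>2)" for x
    proof (cases "x \<le> 0")
      case True
      have "exp (c * x - exp x) \<le> exp (c * x)" by simp
      then show ?thesis using True by (auto intro!: order.trans[OF _ add_increasing2])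
    next
      case False
      then have "exp x \<ge> x\<^sup>2 / 2" using exp_lower_Taylor_quadratic[of x] by simp
      \<comment> \<open>The difference of the two sides is the square of x/2 - c, which is where the
        constant exp (c^2) of the majorant comes from.\<close>
      moreover have "c * x - x\<^sup>2 / 2 \<le> c\<^sup>2 - (1/4) * x\<^sup>2"
        using zero_le_power2[of "x / 2 - c"] by (simp add: power2_eq_square field_simps)
      ultimately have "c * x - exp x \<le> c\<^sup>2 - (1/4) * x\<^sup>2" by linarith
      then show ?thesis using False by (simp flip: exp_add)
    qed
    then show "AE x in lborel. norm (exp (z * of_real x - of_real (exp x))) \<le> norm (indicator {..0} x *\<^sub>R exp (c * x) + exp (c\<^sup>2) * exp (- (1/4) * x\<^sup>2))"
      by (intro AE_I2) (auto simp: c_def intro: order.trans[OF _ abs_ge_self])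
  qed auto
  define f where "f = (\<lambda>t. complex_of_real t powr (z - 1) / of_real (exp t))"
  have cont: "isCont f t" if "t > 0" for t
    unfolding f_def using that by (intro continuous_intros) (auto simp: complex_nonpos_Reals_iff)
  have intf: "set_integrable lborel {0<..} f"
  proof (rule absolutely_integrable_imp_lborel)
    show "f absolutely_integrable_on {0<..}"
      unfolding f_def by (rule absolutely_integrable_Gamma_integral'[OF assms])
    show "set_borel_measurable lborel {0<..} f"
      unfolding set_borel_measurable_def using cont
      by (auto simp: continuous_on_eq_continuous_at intro!: borel_measurable_continuous_on_indicator)
  qed
  have fexp: "exp x *\<^sub>R f (exp x) = exp (z * of_real x - of_real (exp x))" for x
  proof -
    have "complex_of_real (exp x) powr (z - 1) = exp ((z - 1) * of_real x)"
      by (simp add: powr_def Ln_of_real)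
    then show ?thesis
      by (simp add: f_def scaleR_conv_of_real exp_diff left_diff_distrib exp_of_real[symmetric])
  qed
  have "(LBINT x=0..\<infinity>. f x) = (LBINT x=-\<infinity>..\<infinity>. exp x *\<^sub>R f (exp x))"
  proof (rule interval_integral_substitution_integrable)
    show "((ereal \<circ> exp \<circ> real_of_ereal) \<longlongrightarrow> 0) (at_right (-\<infinity>))"
      unfolding zero_ereal_def ereal_tendsto_simps by (rule exp_at_bot)
    show "((ereal \<circ> exp \<circ> real_of_ereal) \<longlongrightarrow> \<infinity>) (at_left \<infinity>)"
      unfolding ereal_tendsto_simps by (rule exp_at_top)
    show "set_integrable lborel (einterval (- \<infinity>) \<infinity>) (\<lambda>x. exp x *\<^sub>R f (exp x))"
      unfolding fexp using int by (simp add: set_integrable_def)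
    show "set_integrable lborel (einterval 0 \<infinity>) f"
      using intf by (simp add: zero_ereal_def)
  qed (auto intro!: cont)
  also have "(LBINT x=-\<infinity>..\<infinity>. exp x *\<^sub>R f (exp x)) = (LINT x|lborel. exp (z * of_real x - of_real (exp x)))"
    unfolding fexp by (simp add: interval_lebesgue_integral_def set_lebesgue_integral_def)
  also have "(LBINT x=0..\<infinity>. f x) = (LINT x:{0<..}|lborel. f x)"
    by (simp add: interval_lebesgue_integral_def zero_ereal_def)
  also have "\<dots> = integral {0<..} f"
    by (rule set_borel_integral_eq_integral[OF intf])
  also have "\<dots> = Gamma z"
    using Gamma_integral_complex'[OF assms] unfolding f_def by (rule integral_unique)
  finally show "(LINT x|lborel. exp (z * of_real x - of_real (exp x))) = Gamma z" by simp
qed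

text \<open>Integration by parts: the derivative of \<open>k\<close> is - s * k - h, where
  \<open>h\<close> is the integrand of Gamma (1 - s), and \<open>k\<close> vanishes at both ends of
  the line. Hence - s times the integral of \<open>k\<close> is Gamma (1 - s) = - s * Gamma (-
  s).\<close>

lemma LINT_exp_exp_1:
  assumes "0 < Re s" "Re s < 1"
  shows "(LINT x|lborel. exp (- s * of_real x) * (exp (- of_real (exp x)) - 1)) = Gamma (- s)"
proof -
  define k where "k = (\<lambda>x::real. exp (- s * of_real x) * (exp (- of_real (exp x)) - 1))"
  define h where "h = (\<lambda>x::real. exp ((1 - s) * of_real x - of_real (exp x)))"
  have bound: "norm (k x) \<le> exp (- Re s * x) * min 2 (exp x)" for x
    using norm_exp_exp_bound[of 1 s x] by (simp add: k_def)
  have intk: "integrable lborel k"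
    using integrable_exp_exp[OF assms, of 1] by (simp add: k_def)
  have inth: "integrable lborel h" "(LINT x|lborel. h x) = Gamma (1 - s)"
    using integrable_Gamma_exp[of "1 - s"] LINT_Gamma_exp[of "1 - s"] assms by (auto simp: h_def)
  have s: "Re s > 0" "1 - Re s > 0" using assms by auto
  have "(LBINT x=-\<infinity>..\<infinity>. - s * k x - h x) = 0 - 0"
  proof (rule interval_integral_FTC_integrable[where F = k])
    have hk: "- s * k x - h x = - s * exp (- s * of_real x) * (exp (- of_real (exp x)) - 1) +
        exp (- s * of_real x) * (exp (- of_real (exp x)) * (- of_real (exp x)))" for x
      by (simp add: k_def h_def exp_diff left_diff_distrib exp_minus exp_add exp_of_real field_simps)
    show "(k has_vector_derivative - s * k x - h x) (at x)" for x
    proof -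
      have "((\<lambda>w. exp (- s * w) * (exp (- exp w) - 1)) has_field_derivative - s * k x - h x) (at (of_real x))"
        unfolding hk by (rule derivative_eq_intros refl)+ (simp add: algebra_simps exp_of_real)
      from has_vector_derivative_real_field[OF this] show ?thesis
        by (simp add: k_def exp_of_real)
    qed
    show "isCont (\<lambda>x. - s * k x - h x) x" for x
      unfolding k_def h_def by (intro continuous_intros)
    show "set_integrable lborel (einterval (-\<infinity>) \<infinity>) (\<lambda>x. - s * k x - h x)"
      using intk inth by (simp add: set_integrable_def)
    have "((\<lambda>x. exp ((1 - Re s) * x)) \<longlongrightarrow> 0) at_bot" using s by real_asymp
    moreover have "norm (k x) \<le> exp ((1 - Re s) * x)" for x
      using bound[of x] by (rule order.trans)
        (auto simp: left_diff_distrib exp_diff exp_minus field_simps)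
    ultimately have "(k \<longlongrightarrow> 0) at_bot"
      by (intro Lim_null_comparison[OF always_eventually, of k]) auto
    then show "((k \<circ> real_of_ereal) \<longlongrightarrow> 0) (at_right (- \<infinity>))"
      unfolding ereal_tendsto_simps1 .
    have "((\<lambda>x. 2 * exp (- Re s * x)) \<longlongrightarrow> 0) at_top" using s by real_asymp
    moreover have "norm (k x) \<le> 2 * exp (- Re s * x)" for x
      using bound[of x] by (rule order.trans) auto
    ultimately have "(k \<longlongrightarrow> 0) at_top"
      by (intro Lim_null_comparison[OF always_eventually, of k]) auto
    then show "((k \<circ> real_of_ereal) \<longlongrightarrow> 0) (at_left \<infinity>)"
      unfolding ereal_tendsto_simps1 .
  qed auto
  also have "(LBINT x=-\<infinity>..\<infinity>. - s * k x - h x) = - s * (LINT x|lborel. k x) - Gamma (1 - s)"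
    using intk inth by (simp add: interval_lebesgue_integral_def set_lebesgue_integral_def)
  finally have "- s * (LINT x|lborel. k x) = Gamma (- s + 1)" by (simp add: add.commute)
  also have "\<dots> = - s * Gamma (- s)"
  proof (rule Gamma_plus1, rule notI)
    assume "- s \<in> \<int>\<^sub>\<le>\<^sub>0"
    then obtain n where "- s = of_int n" by (auto elim: nonpos_Ints_cases)
    then have "- Re s = real_of_int n" by (metis Re_complex_of_real of_real_of_int_eq uminus_complex.sel(1))
    then have "real_of_int n < 0" "real_of_int n > - 1" using assms by auto
    then have "n < 0" "real_of_int (- 1) < real_of_int n" by simp_all
    then show False by (simp only: of_int_less_iff)
  qed
  finally show ?thesis using assms by (auto simp: k_def)
qed

text \<open>Scaling exp x by \<open>a\<close> is a translation of x by ln a, which multiplies exp (-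
  s x) by exp (s * ln a).\<close>

lemma LINT_exp_exp_real:
  fixes a :: real
  assumes "0 < Re s" "Re s < 1" "a > 0"
  shows "(LINT x|lborel. exp (- s * of_real x) * (exp (- of_real a * of_real (exp x)) - 1)) = Gamma (- s) * of_real a powr s"
proof -
  have "(LINT x|lborel. exp (- s * of_real x) * (exp (- of_real a * of_real (exp x)) - 1)) =
     \<bar>1\<bar> *\<^sub>R (LINT x|lborel. exp (- s * of_real (- ln a + 1 * x)) * (exp (- of_real a * of_real (exp (- ln a + 1 * x))) - 1))"
    by (rule lborel_integral_real_affine) simp
  also have "\<dots> = (LINT x|lborel. exp (s * of_real (ln a)) * (exp (- s * of_real x) * (exp (- of_real (exp x)) - 1)))"
  proof -
    have "exp (- s * of_real (- ln a + 1 * x)) * (exp (- of_real a * of_real (exp (- ln a + 1 * x))) - 1) =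
      exp (s * of_real (ln a)) * (exp (- s * of_real x) * (exp (- of_real (exp x)) - 1))" for x
    proof -
      have "a * exp (- ln a + 1 * x) = exp x" using \<open>a > 0\<close> by (simp add: exp_diff)
      then have "- of_real a * of_real (exp (- ln a + 1 * x)) = - complex_of_real (exp x)"
        by (metis minus_mult_left of_real_mult)
      moreover have "exp (- s * of_real (- ln a + 1 * x)) = exp (s * of_real (ln a)) * exp (- s * of_real x)"
        by (simp add: algebra_simps flip: exp_add)
      ultimately show ?thesis by simp
    qed
    then show ?thesis by simp
  qed
  also have "\<dots> = exp (s * of_real (ln a)) * Gamma (- s)"
    by (simp only: integral_mult_right_zero LINT_exp_exp_1[OF assms(1,2)])
  finally show ?thesis using \<open>a > 0\<close> by (simp add: powr_def Ln_of_real)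
qed

lemma LINT_exp_exp:
  assumes "0 < Re s" "Re s < 1" "Re a > 0"
  shows "(LINT x|lborel. exp (- s * of_real x) * (exp (- a * of_real (exp x)) - 1)) = Gamma (- s) * a powr s"
proof (rule right_half_plane_identity[where z = a])
  show "(\<lambda>a. Gamma (- s) * a powr s) holomorphic_on {z. Re z > 0}"
    by (intro holomorphic_intros) (auto simp: complex_nonpos_Reals_iff)
  show "(\<lambda>a. LINT x|lborel. exp (- s * of_real x) * (exp (- a * of_real (exp x)) - 1)) holomorphic_on {z. Re z > 0}"
  proof (rule holomorphic_on_LINT)
    fix z0 assume "z0 \<in> {z. Re z > 0}"
    then have z0: "Re z0 > 0" by simp
    define r where "r = Re z0 / 2"
    have r: "r > 0" using z0 by (simp add: r_def)
    have Re: "Re z \<ge> r" "norm z \<le> norm z0 + r" if "z \<in> cball z0 r" for z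
      using that abs_Re_le_cmod[of "z0 - z"] norm_triangle_ineq2[of z z0]
      by (auto simp: dist_norm r_def abs_le_iff norm_minus_commute)
    show "\<exists>r>0. \<exists>g. integrable lborel g \<and> cball z0 r \<subseteq> {z. Re z > 0} \<and>
      (\<forall>z\<in>cball z0 r. \<forall>x\<in>space lborel. norm (exp (- s * of_real x) * (exp (- z * of_real (exp x)) - 1)) \<le> g x)"
    proof (intro exI conjI ballI)
      show "integrable lborel (\<lambda>x. max 1 (norm z0 + r) * (exp (- Re s * x) * min 2 (exp x)))"
        by (intro integrable_mult_right integrable_exp_min assms)
      show "cball z0 r \<subseteq> {z. Re z > 0}" using Re r by fastforce
      fix z and x :: real assume z: "z \<in> cball z0 r"
      have "norm (exp (- s * of_real x) * (exp (- z * of_real (exp x)) - 1)) \<le> max 1 (norm z) * (exp (- Re s * x) * min 2 (exp x))"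
        using Re(1)[OF z] r by (intro norm_exp_exp_bound) auto
      also have "\<dots> \<le> max 1 (norm z0 + r) * (exp (- Re s * x) * min 2 (exp x))"
        using Re(2)[OF z] by (intro mult_right_mono) auto
      finally show "norm (exp (- s * of_real x) * (exp (- z * of_real (exp x)) - 1)) \<le> \<dots>" .
    qed (rule r)
  qed (auto intro!: holomorphic_intros open_halfspace_Re_gt)
  show "(LINT x|lborel. exp (- s * of_real x) * (exp (- of_real a * of_real (exp x)) - 1)) = Gamma (- s) * of_real a powr s"
    if "a > 0" for a :: real
    using LINT_exp_exp_real[OF assms(1,2) that] .
qed (rule assms)

text \<open>This is the boundary value of \<open>LINT_exp_exp\<close> at - i \<theta>, approached
  from the right half-plane. For nonzero \<theta> this point is off the cut of \<open>powr\<close>,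
  so the right side is continuous there, and the left side converges by domination. For \<theta> = 0
  the integrand vanishes, and so does the right side, since \<open>0 powr s\<close> is 0.\<close>

lemma LINT_exp_exp_imaginary:
  fixes \<theta> :: real
  assumes "0 < Re s" "Re s < 1"
  shows "(LINT x|lborel. exp (- s * of_real x) * (exp (\<i> * of_real \<theta> * of_real (exp x)) - 1)) =
     Gamma (- s) * (of_real \<bar>\<theta>\<bar> powr s * (cos (of_real pi * s / 2) - \<i> * of_real (sgn \<theta>) * sin (of_real pi * s / 2)))"
proof (cases "\<theta> = 0")
  case False
  define b where "b = - \<i> * of_real \<theta>"
  have b: "Re b = 0" "b \<noteq> 0" "b \<notin> \<real>\<^sub>\<le>\<^sub>0" using False by (auto simp: b_def complex_nonpos_Reals_iff)
  have "((\<lambda>e. LINT x|lborel. exp (- s * of_real x) * (exp (- (of_real e + b) * of_real (exp x)) - 1)) \<longlongrightarrow>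
     (LINT x|lborel. exp (- s * of_real x) * (exp (- b * of_real (exp x)) - 1))) (at_right 0)"
  proof (rule tendsto_LINT_at_within)
    show "integrable lborel (\<lambda>x. max 1 (1 + norm b) * (exp (- Re s * x) * min 2 (exp x)))"
      by (intro integrable_mult_right integrable_exp_min assms)
    have "norm (exp (- s * of_real x) * (exp (- (of_real e + b) * of_real (exp x)) - 1)) \<le> max 1 (1 + norm b) * (exp (- Re s * x) * min 2 (exp x))"
      if "e > 0" "e < 1" for e x :: real
    proof -
      have "norm (exp (- s * of_real x) * (exp (- (of_real e + b) * of_real (exp x)) - 1)) \<le> max 1 (norm (of_real e + b)) * (exp (- Re s * x) * min 2 (exp x))"
        using b that by (intro norm_exp_exp_bound) auto
      also have "norm (of_real e + b) \<le> 1 + norm b"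
        using norm_triangle_ineq[of "of_real e" b] that by simp
      then have "max 1 (norm (of_real e + b)) * (exp (- Re s * x) * min 2 (exp x)) \<le> max 1 (1 + norm b) * (exp (- Re s * x) * min 2 (exp x))"
        by (intro mult_right_mono) auto
      finally show ?thesis .
    qed
    then show "\<forall>\<^sub>F e in at_right 0. \<forall>x\<in>space lborel. norm (exp (- s * of_real x) * (exp (- (of_real e + b) * of_real (exp x)) - 1)) \<le> max 1 (1 + norm b) * (exp (- Re s * x) * min 2 (exp x))"
      by (auto simp: eventually_at_right_field intro!: exI[of _ 1])
    show "((\<lambda>e. exp (- s * of_real x) * (exp (- (of_real e + b) * of_real (exp x)) - 1)) \<longlongrightarrow> exp (- s * of_real x) * (exp (- b * of_real (exp x)) - 1)) (at_right 0)" for x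
      by (auto intro!: tendsto_eq_intros)
  qed auto
  moreover have "((\<lambda>e. LINT x|lborel. exp (- s * of_real x) * (exp (- (of_real e + b) * of_real (exp x)) - 1)) \<longlongrightarrow>
     Gamma (- s) * b powr s) (at_right 0)"
  proof (rule Lim_transform_eventually)
    show "((\<lambda>e. Gamma (- s) * (of_real e + b) powr s) \<longlongrightarrow> Gamma (- s) * b powr s) (at_right 0)"
    proof (intro tendsto_mult tendsto_const tendsto_powr_complex b)
      show "((\<lambda>e. of_real e + b) \<longlongrightarrow> b) (at_right 0)" by (auto intro!: tendsto_eq_intros)
    qed
    show "\<forall>\<^sub>F e in at_right 0. Gamma (- s) * (of_real e + b) powr s = (LINT x|lborel. exp (- s * of_real x) * (exp (- (of_real e + b) * of_real (exp x)) - 1))"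
    proof (rule eventually_mono[OF eventually_at_right_less[of "0::real"]])
      fix e :: real assume "0 < e"
      then show "Gamma (- s) * (of_real e + b) powr s = (LINT x|lborel. exp (- s * of_real x) * (exp (- (of_real e + b) * of_real (exp x)) - 1))"
        using b by (intro LINT_exp_exp[OF assms, symmetric]) simp
    qed
  qed
  ultimately have *: "(LINT x|lborel. exp (- s * of_real x) * (exp (- b * of_real (exp x)) - 1)) = Gamma (- s) * b powr s"
    by (rule tendsto_unique[rotated]) simp
  have "b powr s = of_real \<bar>\<theta>\<bar> powr s * exp (- \<i> * of_real (sgn \<theta>) * (of_real pi * s / 2))"
  proof -
    \<comment> \<open>The argument of - i \<theta> is - pi/2 or pi/2 according to the sign of
      \<theta>; this is the source of the trigonometric factors.\<close>
    have L1: "Ln b = of_real (ln \<bar>\<theta>\<bar>) - \<i> * of_real (sgn \<theta>) * of_real pi / 2"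
    proof (rule Ln_unique)
      have pi2: "- (pi / 2) \<le> pi" using pi_gt_zero by linarith
      have "exp (of_real (ln \<bar>\<theta>\<bar>) - \<i> * of_real (sgn \<theta>) * of_real pi / 2) = of_real \<bar>\<theta>\<bar> * exp (\<i> * of_real (- sgn \<theta> * pi / 2))"
      proof -
        have "of_real (ln \<bar>\<theta>\<bar>) - \<i> * of_real (sgn \<theta>) * of_real pi / 2 = complex_of_real (ln \<bar>\<theta>\<bar>) + \<i> * of_real (- sgn \<theta> * pi / 2)"
          by simp
        then show ?thesis using False by (simp only: exp_add exp_of_real) simp
      qed
      also have "\<dots> = b"
        using False by (cases "\<theta> > 0") (auto simp: b_def complex_eq_iff Re_exp Im_exp sgn_if)
      finally show "exp (of_real (ln \<bar>\<theta>\<bar>) - \<i> * of_real (sgn \<theta>) * of_real pi / 2) = b" .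
      show "- pi < Im (of_real (ln \<bar>\<theta>\<bar>) - \<i> * of_real (sgn \<theta>) * of_real pi / 2)"
          "Im (of_real (ln \<bar>\<theta>\<bar>) - \<i> * of_real (sgn \<theta>) * of_real pi / 2) \<le> pi"
        by (auto simp: sgn_if pi2)
    qed
    have L2: "Ln (of_real \<bar>\<theta>\<bar>) = of_real (ln \<bar>\<theta>\<bar>)" using False by (intro Ln_of_real) auto
    show ?thesis using False b by (simp add: powr_def L1 L2 algebra_simps flip: exp_add)
  qed
  also have "exp (- \<i> * of_real (sgn \<theta>) * (of_real pi * s / 2)) = cos (of_real pi * s / 2) - \<i> * of_real (sgn \<theta>) * sin (of_real pi * s / 2)"
    using False exp_Euler[of "of_real pi * s / 2"] exp_Euler[of "- (of_real pi * s / 2)"] by (auto simp: sgn_if)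
  finally show ?thesis using * by (simp add: b_def)
qed auto

section \<open>Schwartz functions and their Fourier transforms\<close>

definition rapidly_bounded :: "(real^'n::finite \<Rightarrow> complex) \<Rightarrow> bool" where
  "rapidly_bounded g \<longleftrightarrow> (\<forall>k. \<exists>C. \<forall>x. norm x ^ k * norm (g x) \<le> C)"

text \<open>The form in which the decay of f and of its Fourier transform enters the continuation:
  powers of \<open>jdet\<close> are dominated by powers of the norm.\<close>

definition moments_integrable :: "(real^'n::finite \<Rightarrow> complex) \<Rightarrow> bool" where
  "moments_integrable g \<longleftrightarrow> g \<in> borel_measurable borel \<and> (\<forall>k. integrable lborel (\<lambda>x. norm x ^ k * norm (g x)))"

text \<open>The product form reduces integrability over the space to one variable, and the weight is
  still bounded below by a negative power of the norm, so every rapidly bounded function lies below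
  a multiple of it.\<close>

definition cauchy_weight :: "real^'n::finite \<Rightarrow> real" where
  "cauchy_weight x = (\<Prod>i\<in>UNIV. inverse (1 + (x $ i)\<^sup>2))"

lemma one_plus_square_pos [simp]: "1 + (a::real)\<^sup>2 > 0" "1 + (a::real)\<^sup>2 \<noteq> 0"
  using zero_le_power2[of a] by linarith+

lemma cauchy_weight_pos: "cauchy_weight x > 0"
  unfolding cauchy_weight_def by (intro prod_pos) auto

lemma integrable_cauchy_weight: "integrable lborel cauchy_weight"
proof -
  have "integrable lborel (\<lambda>x::real. inverse (1 + x\<^sup>2))"
    using integrable_inverse_1_plus_square by (simp add: set_integrable_def)
  then show ?thesis unfolding cauchy_weight_def by (rule integrable_lborel_vec_prod)
qed

text \<open>Each of the \<open>CARD('n)\<close> factors of the inverse weight is at most 2 * max 1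
  (norm x ^ 2), which explains both the exponent and the constant.\<close>

lemma inverse_cauchy_weight_le:
  fixes x :: "real^'n::finite"
  shows "1 \<le> 2 ^ CARD('n) * (1 + norm x ^ (2 * CARD('n))) * cauchy_weight x"
proof -
  let ?n = "CARD('n)"
  have "(\<Prod>i\<in>UNIV. 1 + (x $ i)\<^sup>2) \<le> (\<Prod>i\<in>(UNIV::'n set). 1 + (norm x)\<^sup>2)"
    using component_le_norm_cart[of x] by (intro prod_mono) (simp add: abs_le_square_iff[symmetric])
  also have "\<dots> = (1 + (norm x)\<^sup>2) ^ ?n" by simp
  also have "\<dots> \<le> (2 * max 1 ((norm x)\<^sup>2)) ^ ?n"
    by (intro power_mono) auto
  also have "\<dots> = 2 ^ ?n * max 1 ((norm x)\<^sup>2) ^ ?n" by (simp add: power_mult_distrib)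
  also have "max 1 ((norm x)\<^sup>2) ^ ?n \<le> 1 + norm x ^ (2 * ?n)"
    by (auto simp: max_def power_mult)
  finally have "(\<Prod>i\<in>UNIV. 1 + (x $ i)\<^sup>2) \<le> 2 ^ ?n * (1 + norm x ^ (2 * ?n))" by simp
  then have "(\<Prod>i\<in>UNIV. 1 + (x $ i)\<^sup>2) * cauchy_weight x \<le> 2 ^ ?n * (1 + norm x ^ (2 * ?n)) * cauchy_weight x"
    using cauchy_weight_pos[of x] by (intro mult_right_mono) auto
  also have "(\<Prod>i\<in>UNIV. 1 + (x $ i)\<^sup>2) * cauchy_weight x = 1"
    unfolding cauchy_weight_def by (subst prod.distrib[symmetric]) simp
  finally show ?thesis .
qed

text \<open>It gives difference quotients along an axis one integrable majorant for all increments
  up to 1. The factor 3 per coordinate comes from z^2 <= 2 (z + d)^2 + 2 d^2 with d^2 <= 1.\<close>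

lemma cauchy_weight_shift:
  fixes y :: "real^'n::finite"
  assumes "\<bar>t\<bar> \<le> 1"
  shows "cauchy_weight (y + t *\<^sub>R axis j 1) \<le> 3 ^ CARD('n) * cauchy_weight y"
proof -
  have "cauchy_weight (y + t *\<^sub>R axis j 1) \<le> (\<Prod>i\<in>(UNIV::'n set). 3 * inverse (1 + (y $ i)\<^sup>2))"
    unfolding cauchy_weight_def
  proof (intro prod_mono conjI)
    fix i :: 'n
    define z where "z = y $ i"
    define d where "d = (t *\<^sub>R axis j 1 :: real^'n) $ i"
    have "\<bar>d\<bar> \<le> 1" using assms by (auto simp: d_def axis_def)
    then have "d\<^sup>2 \<le> 1" by (simp add: abs_square_le_1)
    moreover have "z\<^sup>2 \<le> 2 * (z + d)\<^sup>2 + 2 * d\<^sup>2"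
      using zero_le_power2[of "z + 2 * d"] by (simp add: power2_eq_square algebra_simps)
    ultimately have "1 + z\<^sup>2 \<le> 3 * (1 + (z + d)\<^sup>2)"
      using zero_le_power2[of "z + d"] by argo
    then have "inverse (1 + (z + d)\<^sup>2) \<le> 3 * inverse (1 + z\<^sup>2)"
      by (simp add: divide_simps add_pos_nonneg)
    then show "inverse (1 + ((y + t *\<^sub>R axis j 1) $ i)\<^sup>2) \<le> 3 * inverse (1 + (y $ i)\<^sup>2)"
      by (simp add: z_def d_def)
  qed (auto intro: add_nonneg_nonneg)
  then show ?thesis by (simp add: cauchy_weight_def prod.distrib)
qed

lemma rapidly_bounded_cauchy_weight:
  assumes "rapidly_bounded (g :: real^'n::finite \<Rightarrow> complex)"
  shows "\<exists>C\<ge>0. \<forall>x. norm x ^ k * norm (g x) \<le> C * cauchy_weight x"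
proof -
  let ?n = "CARD('n)"
  obtain C1 where C1: "\<And>x. norm x ^ k * norm (g x) \<le> C1"
    using assms unfolding rapidly_bounded_def by blast
  obtain C2 where C2: "\<And>x. norm x ^ (k + 2 * ?n) * norm (g x) \<le> C2"
    using assms unfolding rapidly_bounded_def by blast
  have "norm x ^ k * norm (g x) \<le> (2 ^ ?n * (C1 + C2)) * cauchy_weight x" for x
  proof -
    have "norm x ^ k * norm (g x) * 1 \<le> norm x ^ k * norm (g x) * (2 ^ ?n * (1 + norm x ^ (2 * ?n)) * cauchy_weight x)"
      by (intro mult_left_mono inverse_cauchy_weight_le) auto
    also have "\<dots> = 2 ^ ?n * (norm x ^ k * norm (g x) + norm x ^ (k + 2 * ?n) * norm (g x)) * cauchy_weight x"
      by (simp add: algebra_simps power_add)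
    also have "\<dots> \<le> 2 ^ ?n * (C1 + C2) * cauchy_weight x"
      using C1[of x] C2[of x] cauchy_weight_pos[of x] by (intro mult_right_mono mult_left_mono add_mono) auto
    finally show ?thesis by simp
  qed
  moreover have "C1 \<ge> 0" "C2 \<ge> 0"
    using order.trans[OF _ C1[of 0]] order.trans[OF _ C2[of 0]] by auto
  ultimately show ?thesis by (intro exI[of _ "2 ^ ?n * (C1 + C2)"]) auto
qed

lemma rapidly_bounded_imp_moments_integrable:
  assumes "rapidly_bounded g" "g \<in> borel_measurable borel"
  shows "moments_integrable g"
  unfolding moments_integrable_def
proof (intro conjI allI)
  fix k
  obtain C where C: "\<And>x. norm x ^ k * norm (g x) \<le> C * cauchy_weight x"
    using rapidly_bounded_cauchy_weight[OF assms(1), of k] by blast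
  show "integrable lborel (\<lambda>x. norm x ^ k * norm (g x))"
  proof (rule Bochner_Integration.integrable_bound)
    show "integrable lborel (\<lambda>x. C * cauchy_weight x)"
      by (intro integrable_mult_right integrable_cauchy_weight)
    show "(\<lambda>x. norm x ^ k * norm (g x)) \<in> borel_measurable lborel"
      using assms(2) by measurable
  qed (use C in \<open>auto intro!: AE_I2 intro: order.trans[OF _ abs_ge_self]\<close>)
qed (rule assms)

lemma moments_integrable_imp_integrable:
  assumes "moments_integrable g"
  shows "integrable lborel g"
proof -
  have "integrable lborel (\<lambda>x. norm (g x))"
    using assms by (auto simp: moments_integrable_def dest: spec[of _ 0])
  then show ?thesis
    using assms by (subst integrable_norm_iff[symmetric]) (auto simp: moments_integrable_def)
qed

lemma LINT_lborel_translate: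
  fixes F :: "'a::euclidean_space \<Rightarrow> 'b::{banach, second_countable_topology}"
  assumes "F \<in> borel_measurable borel"
  shows "(LINT y|lborel. F (c + y)) = (LINT y|lborel. F y)"
  by (subst (2) lborel_distr_plus[of c, symmetric], subst integral_distr) (use assms in auto)

lemma differentiable_imp_borel:
  fixes g :: "real^'n::finite \<Rightarrow> complex"
  assumes "\<And>x. g differentiable (at x)"
  shows "g \<in> borel_measurable borel"
  using assms by (intro borel_measurable_continuous_onI)
    (auto simp: continuous_on_eq_continuous_at differentiable_imp_continuous_within)

lemma has_vector_derivative_quotient:
  assumes "(f has_vector_derivative D) (at t)"
  shows "((\<lambda>h. (f (t + h) - f t) /\<^sub>R h) \<longlongrightarrow> D) (at 0)"
proof (rule LIM_zero_cancel, rule tendsto_norm_zero_cancel, rule Lim_transform_eventually)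
  show "((\<lambda>h. norm (f (t + h) - f t - h *\<^sub>R D) / norm h) \<longlongrightarrow> 0) (at 0)"
    using assms by (simp add: has_vector_derivative_def has_derivative_at)
  have "norm (f (t + h) - f t - h *\<^sub>R D) / norm h = norm ((f (t + h) - f t) /\<^sub>R h - D)" if "h \<noteq> 0" for h
  proof -
    have "(f (t + h) - f t) /\<^sub>R h - D = (f (t + h) - f t - h *\<^sub>R D) /\<^sub>R h"
      using that by (simp add: scaleR_diff_right)
    then show ?thesis by (simp add: divide_inverse mult.commute)
  qed
  then show "\<forall>\<^sub>F h in at 0. norm (f (t + h) - f t - h *\<^sub>R D) / norm h = norm ((f (t + h) - f t) /\<^sub>R h - D)"
    using eventually_neq_at_within[of 0 0 UNIV] by (auto elim!: eventually_mono)
qed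

lemma partial_deriv_line:
  assumes "\<And>x. g differentiable (at x)"
  shows "((\<lambda>t. g (y + t *\<^sub>R axis j 1)) has_vector_derivative partial_deriv j g (y + t *\<^sub>R axis j 1)) (at t)"
proof -
  define D where "D = frechet_derivative g (at (y + t *\<^sub>R axis j 1))"
  have D: "(g has_derivative D) (at (y + t *\<^sub>R axis j 1))"
    using assms unfolding D_def frechet_derivative_works by blast
  have "((\<lambda>t. y + t *\<^sub>R axis j 1) has_derivative (\<lambda>h. h *\<^sub>R axis j 1)) (at t)"
    by (auto intro!: derivative_eq_intros)
  from has_derivative_compose[OF this D]
  have "((\<lambda>t. g (y + t *\<^sub>R axis j 1)) has_derivative (\<lambda>h. D (h *\<^sub>R axis j 1))) (at t)" .
  then show ?thesis
    unfolding has_vector_derivative_def partial_deriv_def D_def[symmetric]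
    using linear_scale[OF has_derivative_linear[OF D]] by simp
qed

text \<open>Differentiating under a translation of the integrand avoids an integration by parts in a
  single coordinate.\<close>

lemma fourier_partial_deriv:
  fixes g :: "real^'n::finite \<Rightarrow> complex"
  assumes diff: "\<And>x. g differentiable (at x)" and rb: "rapidly_bounded g" "rapidly_bounded (partial_deriv j g)"
    and meas[measurable]: "partial_deriv j g \<in> borel_measurable borel"
  shows "fourier (partial_deriv j g) x = - \<i> * of_real (x $ j) * fourier g x"
proof -
  define e :: "real^'n" where "e = axis j 1"
  have [measurable]: "g \<in> borel_measurable borel" by (rule differentiable_imp_borel[OF diff])
  have intg: "integrable lborel g"
    by (intro moments_integrable_imp_integrable rapidly_bounded_imp_moments_integrable rb) measurable
  have inte: "integrable lborel (\<lambda>y. exp (\<i> * of_real (x \<bullet> y)) * g y)"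
    by (rule Bochner_Integration.integrable_bound[OF intg]) (auto simp: norm_mult)
  obtain C where C: "C \<ge> 0" "\<And>x. norm (partial_deriv j g x) \<le> C * cauchy_weight x"
    using rapidly_bounded_cauchy_weight[OF rb(2), of 0] by auto
  \<comment> \<open>The mean value inequality along the segment from y to y + h e, with the weight
    moved back to y at the cost of a constant: after division by h the bound is integrable and free
    of h.\<close>
  have mv: "norm (g (y + h *\<^sub>R e) - g y) \<le> h * (C * 3 ^ CARD('n) * cauchy_weight y)" if h: "0 < h" "h < 1" for h y
  proof -
    have "norm (g (y + h *\<^sub>R e) - g (y + 0 *\<^sub>R e)) \<le> (C * 3 ^ CARD('n) * cauchy_weight y) * h - (C * 3 ^ CARD('n) * cauchy_weight y) * 0"
    proof (rule differentiable_bound_general[OF h(1)])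
      show "((\<lambda>t. g (y + t *\<^sub>R e)) has_vector_derivative partial_deriv j g (y + t *\<^sub>R e)) (at t)" for t
        unfolding e_def by (rule partial_deriv_line[OF diff])
      then show "continuous_on {0..h} (\<lambda>t. g (y + t *\<^sub>R e))"
        by (intro continuous_at_imp_continuous_on ballI has_vector_derivative_continuous)
      fix t assume t: "0 < t" "t < h"
      have "norm (partial_deriv j g (y + t *\<^sub>R e)) \<le> C * cauchy_weight (y + t *\<^sub>R e)" by (rule C)
      also have "\<dots> \<le> C * (3 ^ CARD('n) * cauchy_weight y)"
        unfolding e_def using t h by (intro mult_left_mono cauchy_weight_shift C) auto
      finally show "norm (partial_deriv j g (y + t *\<^sub>R e)) \<le> C * 3 ^ CARD('n) * cauchy_weight y" by simp
      show "((*) (C * 3 ^ CARD('n) * cauchy_weight y) has_vector_derivative C * 3 ^ CARD('n) * cauchy_weight y) (at t)"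
        by (auto intro!: derivative_eq_intros)
    qed (auto intro!: continuous_intros)
    then show ?thesis by (simp add: mult_ac)
  qed
  \<comment> \<open>Translation invariance moves the increment from \<open>g\<close> to the
    exponential, so the same integral has two limits to compare as h tends to 0: the transform of
    the derivative, and the derivative of the factor exp (- i h x_j).\<close>
  have shift: "(LINT y|lborel. (g (y + h *\<^sub>R e) - g y) / of_real h * exp (\<i> * of_real (x \<bullet> y))) =
      (exp (- \<i> * of_real (h * x $ j)) - 1) / of_real h * fourier g x" if "h \<noteq> 0" for h
  proof -
    define F where "F y = exp (- \<i> * of_real (h * x $ j)) * (exp (\<i> * of_real (x \<bullet> y)) * g y)" for y
    have [measurable]: "F \<in> borel_measurable borel" unfolding F_def by measurable
    have intF: "integrable lborel F" unfolding F_def by (intro integrable_mult_right inte)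
    have Fs: "F (h *\<^sub>R e + y) = exp (\<i> * of_real (x \<bullet> y)) * g (y + h *\<^sub>R e)" for y
    proof -
      have "x \<bullet> (h *\<^sub>R e + y) = h * x $ j + x \<bullet> y"
        by (simp add: inner_add_right e_def cart_eq_inner_axis)
      then have "exp (- \<i> * of_real (h * x $ j)) * exp (\<i> * of_real (x \<bullet> (h *\<^sub>R e + y))) = exp (\<i> * of_real (x \<bullet> y))"
        by (simp add: ring_distribs flip: exp_add)
      then show ?thesis by (simp add: F_def add.commute[of _ y] flip: mult.assoc)
    qed
    have "integrable (distr lborel borel ((+) (h *\<^sub>R e))) F"
      unfolding lborel_distr_plus by (rule intF)
    then have i1: "integrable lborel (\<lambda>y. exp (\<i> * of_real (x \<bullet> y)) * g (y + h *\<^sub>R e))"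
      by (subst (asm) integrable_distr_eq) (auto simp: Fs)
    have "(LINT y|lborel. (g (y + h *\<^sub>R e) - g y) / of_real h * exp (\<i> * of_real (x \<bullet> y))) =
       (LINT y|lborel. (exp (\<i> * of_real (x \<bullet> y)) * g (y + h *\<^sub>R e) - exp (\<i> * of_real (x \<bullet> y)) * g y) / of_real h)"
      by (intro Bochner_Integration.integral_cong) (auto simp: field_simps diff_divide_distrib)
    also have "\<dots> = ((LINT y|lborel. exp (\<i> * of_real (x \<bullet> y)) * g (y + h *\<^sub>R e)) - fourier g x) / of_real h"
      using i1 inte by (simp add: fourier_def)
    also have "(LINT y|lborel. exp (\<i> * of_real (x \<bullet> y)) * g (y + h *\<^sub>R e)) = (LINT y|lborel. F y)"
      unfolding Fs[symmetric] by (rule LINT_lborel_translate) measurable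
    also have "\<dots> = exp (- \<i> * of_real (h * x $ j)) * fourier g x"
      unfolding F_def fourier_def by simp
    finally show ?thesis by (simp add: left_diff_distrib diff_divide_distrib)
  qed
  have "((\<lambda>h. LINT y|lborel. (g (y + h *\<^sub>R e) - g y) / of_real h * exp (\<i> * of_real (x \<bullet> y)))
      \<longlongrightarrow> (LINT y|lborel. partial_deriv j g y * exp (\<i> * of_real (x \<bullet> y)))) (at_right 0)"
  proof (rule tendsto_LINT_at_within)
    show "integrable lborel (\<lambda>y. C * 3 ^ CARD('n) * cauchy_weight y)"
      by (intro integrable_mult_right integrable_cauchy_weight)
    have "norm ((g (y + h *\<^sub>R e) - g y) / of_real h * exp (\<i> * of_real (x \<bullet> y))) \<le> C * 3 ^ CARD('n) * cauchy_weight y" if "0 < h" "h < 1" for h y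
      using mv[OF that, of y] that by (simp add: norm_mult norm_divide divide_simps mult_ac)
    then show "\<forall>\<^sub>F h in at_right 0. \<forall>y\<in>space lborel. norm ((g (y + h *\<^sub>R e) - g y) / of_real h * exp (\<i> * of_real (x \<bullet> y))) \<le> C * 3 ^ CARD('n) * cauchy_weight y"
      by (auto simp: eventually_at_right_field intro!: exI[of _ 1])
    fix y
    have "((\<lambda>h. (g (y + h *\<^sub>R e) - g y) /\<^sub>R h) \<longlongrightarrow> partial_deriv j g y) (at 0)"
      using has_vector_derivative_quotient[OF partial_deriv_line[OF diff, where y = y and t = 0 and j = j]]
      by (simp add: e_def)
    then have "((\<lambda>h. (g (y + h *\<^sub>R e) - g y) / of_real h) \<longlongrightarrow> partial_deriv j g y) (at_right 0)"
      by (simp add: scaleR_conv_of_real divide_inverse mult.commute filterlim_at_split)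
    then show "((\<lambda>h. (g (y + h *\<^sub>R e) - g y) / of_real h * exp (\<i> * of_real (x \<bullet> y))) \<longlongrightarrow> partial_deriv j g y * exp (\<i> * of_real (x \<bullet> y))) (at_right 0)"
      by (intro tendsto_mult tendsto_const)
  qed auto
  moreover have "((\<lambda>h. LINT y|lborel. (g (y + h *\<^sub>R e) - g y) / of_real h * exp (\<i> * of_real (x \<bullet> y)))
      \<longlongrightarrow> - \<i> * of_real (x $ j) * fourier g x) (at_right 0)"
  proof (rule Lim_transform_eventually)
    have "((\<lambda>w. exp (- \<i> * of_real (x $ j) * w)) has_field_derivative - \<i> * of_real (x $ j)) (at (of_real 0))"
      by (auto intro!: derivative_eq_intros)
    from has_vector_derivative_quotient[OF has_vector_derivative_real_field[OF this]]
    have "((\<lambda>h. (exp (- \<i> * of_real (x $ j) * of_real h) - 1) /\<^sub>R h) \<longlongrightarrow> - \<i> * of_real (x $ j)) (at 0)"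
      by simp
    then have "((\<lambda>h. (exp (- \<i> * of_real (h * x $ j)) - 1) / of_real h) \<longlongrightarrow> - \<i> * of_real (x $ j)) (at_right 0)"
      by (simp add: scaleR_conv_of_real divide_inverse mult_ac filterlim_at_split)
    then show "((\<lambda>h. (exp (- \<i> * of_real (h * x $ j)) - 1) / of_real h * fourier g x) \<longlongrightarrow> - \<i> * of_real (x $ j) * fourier g x) (at_right 0)"
      by (intro tendsto_mult tendsto_const)
    show "\<forall>\<^sub>F h in at_right 0. (exp (- \<i> * of_real (h * x $ j)) - 1) / of_real h * fourier g x = (LINT y|lborel. (g (y + h *\<^sub>R e) - g y) / of_real h * exp (\<i> * of_real (x \<bullet> y)))"
      using eventually_at_right_less[of "0::real"] by eventually_elim (intro shift[symmetric], simp)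
  qed
  ultimately have "(LINT y|lborel. partial_deriv j g y * exp (\<i> * of_real (x \<bullet> y))) = - \<i> * of_real (x $ j) * fourier g x"
    by (rule tendsto_unique[rotated]) simp
  then show ?thesis by (simp add: fourier_def mult.commute)
qed

lemma
  assumes "schwartz f"
  shows schwartz_partial_deriv: "schwartz (partial_deriv j f)"
    and schwartz_differentiable: "\<And>x. f differentiable (at x)"
    and schwartz_rapidly_bounded: "rapidly_bounded f"
proof -
  show "schwartz (partial_deriv j f)"
    unfolding schwartz_def
  proof (intro allI)
    \<comment> \<open>\<open>foldr\<close> applies the last entry of a list first, so a derivative
      taken beforehand is appended at the end.\<close>
    fix js show "(\<forall>x. foldr partial_deriv js (partial_deriv j f) differentiable at x) \<and>
         (\<forall>k. \<exists>C. \<forall>x. norm x ^ k * norm (foldr partial_deriv js (partial_deriv j f) x) \<le> C)"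
      using assms[unfolded schwartz_def, rule_format, of "js @ [j]"] by simp
  qed
  show "f differentiable (at x)" for x
    using assms[unfolded schwartz_def, rule_format, of "[]"] by simp
  show "rapidly_bounded f"
    unfolding rapidly_bounded_def using assms[unfolded schwartz_def, rule_format, of "[]"] by simp
qed

lemma schwartz_moments_integrable:
  assumes "schwartz f"
  shows "moments_integrable f"
  by (intro rapidly_bounded_imp_moments_integrable differentiable_imp_borel
        schwartz_rapidly_bounded schwartz_differentiable assms)

lemma norm_fourier_le: "norm (fourier g x) \<le> (LINT y|lborel. norm (g y))"
proof -
  have "norm (fourier g x) \<le> (LINT y|lborel. norm (exp (\<i> * of_real (x \<bullet> y)) * g y))"
    unfolding fourier_def by (rule integral_norm_bound)
  then show ?thesis by (simp add: norm_mult)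
qed

text \<open>Each factor \<open>x $ j\<close> is traded for a derivative of f, which is again a
  Schwartz function; therefore the induction keeps f arbitrary.\<close>

lemma schwartz_fourier_decay:
  "schwartz f \<Longrightarrow> \<exists>C. \<forall>x. \<bar>x $ j\<bar> ^ k * norm (fourier f x) \<le> C"
proof (induction k arbitrary: f)
  case 0
  then show ?case using norm_fourier_le by auto
next
  case (Suc k)
  note S = schwartz_partial_deriv[OF Suc.prems, of j]
  obtain C where C: "\<And>x. \<bar>x $ j\<bar> ^ k * norm (fourier (partial_deriv j f) x) \<le> C"
    using Suc.IH[OF S] by blast
  have "fourier (partial_deriv j f) x = - \<i> * of_real (x $ j) * fourier f x" for x
    by (intro fourier_partial_deriv schwartz_differentiable schwartz_rapidly_bounded
        differentiable_imp_borel S Suc.prems)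
  then show ?case using C by (auto simp: norm_mult mult_ac intro!: exI[of _ C])
qed

lemma schwartz_fourier_moments_integrable:
  fixes f :: "real^'n::finite \<Rightarrow> complex"
  assumes "schwartz f"
  shows "moments_integrable (fourier f)"
proof (rule rapidly_bounded_imp_moments_integrable)
  have [measurable]: "f \<in> borel_measurable borel"
    using schwartz_moments_integrable[OF assms] by (simp add: moments_integrable_def)
  show "fourier f \<in> borel_measurable borel"
    unfolding fourier_def by measurable
  show "rapidly_bounded (fourier f)"
    unfolding rapidly_bounded_def
  proof
    fix k
    obtain C where C: "\<And>j x. \<bar>x $ j\<bar> ^ k * norm (fourier f x) \<le> C j"
      using schwartz_fourier_decay[OF assms, of _ k] by metis
    have "norm x ^ k * norm (fourier f x) \<le> real CARD('n) ^ k * (\<Sum>j\<in>UNIV. C j)" for x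
    proof -
      \<comment> \<open>Decay is known only in powers of single coordinates. The largest one
        controls the norm up to the factor \<open>CARD('n)\<close>; as its index depends on x, the
        constants are summed over all indices.\<close>
      define m where "m = Max (range (\<lambda>j. \<bar>x $ j\<bar>))"
      have m: "\<bar>x $ j\<bar> \<le> m" for j unfolding m_def by (intro Max_ge) auto
      have "m \<in> range (\<lambda>j. \<bar>x $ j\<bar>)" unfolding m_def by (intro Max_in) auto
      then obtain j where j: "m = \<bar>x $ j\<bar>" by auto
      have "norm x \<le> (\<Sum>j\<in>UNIV. \<bar>x $ j\<bar>)" by (rule norm_le_l1_cart)
      also have "\<dots> \<le> real CARD('n) * m" using m by (intro sum_bounded_above) auto
      finally have "norm x ^ k \<le> (real CARD('n) * m) ^ k" by (intro power_mono) auto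
      then have "norm x ^ k * norm (fourier f x) \<le> (real CARD('n) * m) ^ k * norm (fourier f x)"
        by (intro mult_right_mono) auto
      also have "\<dots> = real CARD('n) ^ k * (\<bar>x $ j\<bar> ^ k * norm (fourier f x))"
        by (simp add: power_mult_distrib j)
      also have "\<dots> \<le> real CARD('n) ^ k * C j"
        by (intro mult_left_mono C) auto
      also have "C j \<le> (\<Sum>j\<in>UNIV. C j)"
        using order.trans[OF _ C] by (intro member_le_sum) auto
      finally show ?thesis by (simp add: mult_left_mono)
    qed
    then show "\<exists>C. \<forall>x. norm x ^ k * norm (fourier f x) \<le> C" by blast
  qed
qed

section \<open>The oscillatory transform and its duality\<close>

definition quad_sign :: "'p + 'q \<Rightarrow> real" where
  "quad_sign i = (case i of Inl _ \<Rightarrow> 1 | Inr _ \<Rightarrow> - 1)"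

lemma quad_sign_simps [simp]: "quad_sign (Inl a) = 1" "quad_sign (Inr b) = - 1"
  by (simp_all add: quad_sign_def)

lemma quad_sign_cases: "quad_sign i = 1 \<or> quad_sign i = - 1"
  by (cases i) auto

lemma abs_quad_sign [simp]: "\<bar>quad_sign i\<bar> = 1"
  by (cases i) auto

lemma sum_UNIV_Plus:
  fixes h :: "'p::finite + 'q::finite \<Rightarrow> 'a::comm_monoid_add"
  shows "(\<Sum>i\<in>UNIV. h i) = (\<Sum>i\<in>UNIV. h (Inl i)) + (\<Sum>j\<in>UNIV. h (Inr j))"
  using sum.Plus[of "UNIV :: 'p set" "UNIV :: 'q set" h] by (simp add: o_def)

lemma prod_UNIV_Plus:
  fixes h :: "'p::finite + 'q::finite \<Rightarrow> 'a::comm_monoid_mult"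
  shows "(\<Prod>i\<in>UNIV. h i) = (\<Prod>i\<in>UNIV. h (Inl i)) * (\<Prod>j\<in>UNIV. h (Inr j))"
  using prod.Plus[of "UNIV :: 'p set" "UNIV :: 'q set" h] by (simp add: o_def)

lemma jdet_eq_sum: "jdet x = (\<Sum>i\<in>UNIV. quad_sign i * (x $ i)\<^sup>2)"
  by (simp add: jdet_def sum_UNIV_Plus sum_negf)

lemma jdet_measurable [measurable]: "jdet \<in> borel_measurable borel"
  unfolding jdet_def by measurable

lemma abs_jdet_le: "\<bar>jdet x\<bar> \<le> (norm x)\<^sup>2"
proof -
  have "\<bar>jdet x\<bar> \<le> (\<Sum>i\<in>UNIV. \<bar>quad_sign i * (x $ i)\<^sup>2\<bar>)"
    unfolding jdet_eq_sum by (rule sum_abs)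
  also have "\<dots> = (\<Sum>i\<in>UNIV. x $ i * x $ i)"
    by (intro sum.cong) (auto simp: abs_mult power2_eq_square)
  also have "\<dots> = (norm x)\<^sup>2" by (simp add: power2_norm_eq_inner inner_vec_def)
  finally show ?thesis .
qed

lemma integrable_lborel_times:
  fixes h :: "'a::euclidean_space \<Rightarrow> real" and k :: "'b::euclidean_space \<Rightarrow> real"
  assumes "integrable lborel h" "integrable lborel k"
  shows "integrable (lborel \<Otimes>\<^sub>M lborel) (\<lambda>(x, y). h x * k y)"
proof (rule lborel_pair.Fubini_integrable)
  have [measurable]: "h \<in> borel_measurable borel" "k \<in> borel_measurable borel"
    using assms by (auto dest: borel_measurable_integrable)
  show "(\<lambda>(x, y). h x * k y) \<in> borel_measurable (lborel \<Otimes>\<^sub>M lborel)" by measurable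
  show "integrable lborel (\<lambda>x. LINT y|lborel. norm (case (x, y) of (x, y) \<Rightarrow> h x * k y))"
    using assms(1) by (simp add: abs_mult)
  show "AE x in lborel. integrable lborel (\<lambda>y. case (x, y) of (x, y) \<Rightarrow> h x * k y)"
    using assms(2) by simp
qed

text \<open>The factor 1/2 is chosen so that the Gaussian duality sends t to - 1 / t without a
  further scaling constant.\<close>

definition osc :: "(real^('p::finite + 'q::finite) \<Rightarrow> complex) \<Rightarrow> real \<Rightarrow> complex" where
  "osc f t = (LINT x|lborel. iexp (t * (jdet x / 2)) * f x)"

definition osc_coeff :: "(real^('p::finite + 'q::finite) \<Rightarrow> complex) \<Rightarrow> nat \<Rightarrow> complex" where
  "osc_coeff f k = (LINT x|lborel. (\<i> * of_real (jdet x / 2)) ^ k / fact k * f x)"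

lemma iexp_taylor: "norm (iexp y - (\<Sum>k<N. (\<i> * of_real y) ^ k / fact k)) \<le> \<bar>y\<bar> ^ N"
proof (cases N)
  case (Suc n)
  have "norm (iexp y - (\<Sum>k\<le>n. (\<i> * of_real y) ^ k / fact k)) \<le> \<bar>y\<bar> ^ Suc n / fact (Suc n)"
    by (rule iexp_approx1)
  also have "\<dots> \<le> \<bar>y\<bar> ^ Suc n / 1"
    by (intro divide_left_mono fact_ge_1) auto
  finally show ?thesis using Suc by (simp add: lessThan_Suc_atMost)
qed simp

context
  fixes f :: "real^('p::finite + 'q::finite) \<Rightarrow> complex"
  assumes mom: "moments_integrable f"
begin

lemma moments_meas [measurable]: "f \<in> borel_measurable borel"
  using mom by (simp add: moments_integrable_def)

lemma integrable_jdet_power: "integrable lborel (\<lambda>x. \<bar>jdet x / 2\<bar> ^ k * norm (f x))"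
proof (rule Bochner_Integration.integrable_bound)
  show "integrable lborel (\<lambda>x. norm x ^ (2 * k) * norm (f x))"
    using mom by (simp add: moments_integrable_def)
  have "\<bar>jdet x / 2\<bar> ^ k * norm (f x) \<le> norm x ^ (2 * k) * norm (f x)" for x
  proof -
    have "\<bar>jdet x / 2\<bar> \<le> (norm x)\<^sup>2" using abs_jdet_le[of x] by (simp add: abs_divide)
    then have "\<bar>jdet x / 2\<bar> ^ k \<le> ((norm x)\<^sup>2) ^ k" by (rule power_mono) simp
    then show ?thesis by (simp add: power_mult mult_right_mono)
  qed
  then show "AE x in lborel. norm (\<bar>jdet x / 2\<bar> ^ k * norm (f x)) \<le> norm (norm x ^ (2 * k) * norm (f x))"
    by (intro AE_I2) simp
qed measurable

lemma integrable_osc: "integrable lborel (\<lambda>x. iexp (t * (jdet x / 2)) * f x)"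
  by (rule Bochner_Integration.integrable_bound[OF moments_integrable_imp_integrable[OF mom]])
    (auto simp: norm_mult)

text \<open>The Taylor remainder of \<open>iexp\<close> is at most the N-th power of the absolute
  value of its argument for every real argument. Integrating it against f leaves the N-th moment of
  \<open>jdet\<close>, so the bound is global in t.\<close>

lemma osc_expansion:
  "\<exists>C. \<forall>t. norm (osc f t - (\<Sum>k<N. osc_coeff f k * of_real t ^ k)) \<le> C * \<bar>t\<bar> ^ N"
proof (intro exI allI)
  fix t
  have int: "integrable lborel (\<lambda>x. (\<i> * of_real (jdet x / 2)) ^ k / fact k * f x)" for k
  proof (rule Bochner_Integration.integrable_bound[OF integrable_jdet_power[of k]])
    show "AE x in lborel. norm ((\<i> * of_real (jdet x / 2)) ^ k / fact k * f x) \<le> norm (\<bar>jdet x / 2\<bar> ^ k * norm (f x))"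
    proof (intro AE_I2)
      fix x
      have "norm ((\<i> * of_real (jdet x / 2)) ^ k / fact k * f x) = \<bar>jdet x / 2\<bar> ^ k * norm (f x) / fact k"
        by (simp add: norm_mult norm_divide norm_power)
      also have "\<dots> \<le> \<bar>jdet x / 2\<bar> ^ k * norm (f x) / 1"
        by (intro divide_left_mono fact_ge_1) auto
      finally show "norm ((\<i> * of_real (jdet x / 2)) ^ k / fact k * f x) \<le> norm (\<bar>jdet x / 2\<bar> ^ k * norm (f x))" by simp
    qed
  qed measurable
  have "osc f t - (\<Sum>k<N. osc_coeff f k * of_real t ^ k) =
      (LINT x|lborel. iexp (t * (jdet x / 2)) * f x - (\<Sum>k<N. (\<i> * of_real (jdet x / 2)) ^ k / fact k * f x * of_real t ^ k))"
    unfolding osc_def osc_coeff_def integral_mult_left_zero[symmetric]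
    by (subst Bochner_Integration.integral_diff, rule integrable_osc)
      (intro Bochner_Integration.integrable_sum integrable_mult_left int,
       subst Bochner_Integration.integral_sum, intro integrable_mult_left int, rule refl)
  also have "norm \<dots> \<le> (LINT x|lborel. \<bar>t\<bar> ^ N * (\<bar>jdet x / 2\<bar> ^ N * norm (f x)))"
  proof (rule Bochner_Integration.integral_norm_bound_integral)
    show "integrable lborel (\<lambda>x. iexp (t * (jdet x / 2)) * f x - (\<Sum>k<N. (\<i> * of_real (jdet x / 2)) ^ k / fact k * f x * of_real t ^ k))"
      using int integrable_osc by (intro Bochner_Integration.integrable_diff Bochner_Integration.integrable_sum integrable_mult_left) auto
    show "integrable lborel (\<lambda>x. \<bar>t\<bar> ^ N * (\<bar>jdet x / 2\<bar> ^ N * norm (f x)))"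
      by (intro integrable_mult_right integrable_jdet_power)
    fix x :: "real^('p + 'q)"
    define y where "y = t * (jdet x / 2)"
    have "iexp y * f x - (\<Sum>k<N. (\<i> * of_real (jdet x / 2)) ^ k / fact k * f x * of_real t ^ k) =
        (iexp y - (\<Sum>k<N. (\<i> * of_real y) ^ k / fact k)) * f x"
      by (simp add: left_diff_distrib right_diff_distrib sum_distrib_left sum_distrib_right y_def power_mult_distrib mult_ac power_divide)
    also have "norm \<dots> \<le> \<bar>y\<bar> ^ N * norm (f x)"
      unfolding norm_mult by (intro mult_right_mono iexp_taylor) auto
    finally show "norm (iexp (t * (jdet x / 2)) * f x - (\<Sum>k<N. (\<i> * of_real (jdet x / 2)) ^ k / fact k * f x * of_real t ^ k)) \<le> \<bar>t\<bar> ^ N * (\<bar>jdet x / 2\<bar> ^ N * norm (f x))"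
      by (simp add: y_def abs_mult power_mult_distrib power_divide mult_ac)
  qed
  also have "\<dots> = (LINT x|lborel. \<bar>jdet x / 2\<bar> ^ N * norm (f x)) * \<bar>t\<bar> ^ N"
    by simp
  finally show "norm (osc f t - (\<Sum>k<N. osc_coeff f k * of_real t ^ k)) \<le> (LINT x|lborel. \<bar>jdet x / 2\<bar> ^ N * norm (f x)) * \<bar>t\<bar> ^ N" .
qed

lemma osc_expands:
  fixes \<sigma> :: real
  assumes "\<bar>\<sigma>\<bar> = 1"
  shows "expands_at_minus_infinity (\<lambda>x. osc f (\<sigma> * exp x)) (\<lambda>k. osc_coeff f k * of_real \<sigma> ^ k)"
  unfolding expands_at_minus_infinity_def
proof (intro conjI allI)
  show "(\<lambda>x. osc f (\<sigma> * exp x)) \<in> borel_measurable borel"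
    unfolding osc_def by measurable
  fix N
  obtain C where C: "\<And>t. norm (osc f t - (\<Sum>k<N. osc_coeff f k * of_real t ^ k)) \<le> C * \<bar>t\<bar> ^ N"
    using osc_expansion by blast
  have "norm (osc f (\<sigma> * exp x) - (\<Sum>k<N. osc_coeff f k * of_real \<sigma> ^ k * exp (of_nat k * of_real x))) \<le> C * exp (real N * x)" for x
    using C[of "\<sigma> * exp x"] assms
    by (simp add: power_mult_distrib abs_mult mult.assoc exp_of_nat_mult exp_of_real)
  then show "\<exists>C. \<forall>x\<le>0. norm (osc f (\<sigma> * exp x) - (\<Sum>k<N. osc_coeff f k * of_real \<sigma> ^ k * exp (of_nat k * of_real x))) \<le> C * exp (real N * x)"
    by blast
qed

lemma osc_coeff_0: "osc_coeff f 0 = osc f 0"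
  by (simp add: osc_coeff_def osc_def)

end

text \<open>The multiplication formula for the Fourier transform with a Gaussian as second function.
  The damping Re (c i) > 0 makes the double integral absolutely convergent; imaginary exponents are
  reached only as a limit, in \<open>osc_fourier\<close>.\<close>

lemma fourier_gaussian_fubini:
  fixes f :: "real^'n::finite \<Rightarrow> complex" and c :: "'n \<Rightarrow> complex"
  assumes f: "integrable lborel f" and c: "\<And>i. Re (c i) > 0"
  shows "(LINT x|lborel. exp (- (\<Sum>i\<in>UNIV. c i * of_real ((x $ i)\<^sup>2))) * fourier f x) =
     (\<Prod>i\<in>UNIV. of_real (sqrt pi) / csqrt (c i)) *
     (LINT y|lborel. exp (- (\<Sum>i\<in>UNIV. of_real ((y $ i)\<^sup>2) / (4 * c i))) * f y)"
proof -
  have [measurable]: "f \<in> borel_measurable borel" using f by (auto dest: borel_measurable_integrable)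
  define G where "G x y = exp (\<i> * of_real (y \<bullet> x) - (\<Sum>i\<in>UNIV. c i * of_real ((x $ i)\<^sup>2))) * f y" for x y :: "real^'n"
  have intG: "integrable (lborel \<Otimes>\<^sub>M lborel) (case_prod G)"
  proof (rule Bochner_Integration.integrable_bound)
    \<comment> \<open>The Gaussian factor is the case of frequency 0 in
      \<open>integrable_gaussian_vec\<close>; taking norms removes the oscillation of
      \<open>G\<close>.\<close>
    show "integrable (lborel \<Otimes>\<^sub>M lborel) (\<lambda>(x, y). norm (exp (\<i> * of_real (0 \<bullet> x) - (\<Sum>i\<in>UNIV. c i * of_real ((x $ i)\<^sup>2)))) * norm (f y))"
      by (intro integrable_lborel_times integrable_norm integrable_gaussian_vec c f)
    have [measurable]: "(\<lambda>x::real^'n. x $ i) \<in> borel_measurable borel" for i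
      by (intro borel_measurable_continuous_onI continuous_intros)
    show "case_prod G \<in> borel_measurable (lborel \<Otimes>\<^sub>M lborel)"
      unfolding G_def by measurable
  qed (auto simp: G_def norm_mult)
  have "(LINT x|lborel. exp (- (\<Sum>i\<in>UNIV. c i * of_real ((x $ i)\<^sup>2))) * fourier f x) = (LINT x|lborel. LINT y|lborel. G x y)"
    unfolding fourier_def integral_mult_right_zero[symmetric]
    by (intro Bochner_Integration.integral_cong refl)
      (simp add: G_def exp_diff exp_minus inner_commute field_simps)
  also have "\<dots> = (LINT y|lborel. LINT x|lborel. G x y)"
    by (rule lborel_pair.Fubini_integral[OF intG, symmetric])
  also have "\<dots> = (LINT y|lborel. (\<Prod>i\<in>UNIV. of_real (sqrt pi) / csqrt (c i)) * exp (- (\<Sum>i\<in>UNIV. of_real ((y $ i)\<^sup>2) / (4 * c i))) * f y)"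
    unfolding G_def by (simp only: integral_mult_left_zero gaussian_fourier_vec[of c, OF c])
  finally show ?thesis by (simp only: mult.assoc integral_mult_right_zero)
qed

text \<open>Adding a small e > 0 to the imaginary coefficients makes
  \<open>fourier_gaussian_fubini\<close> applicable. As e tends to 0 both integrals converge by
  domination, with norm f and norm (fourier f) as majorants, and the roots converge because the
  limit coefficients are nonzero and imaginary, hence off the cut of \<open>csqrt\<close>.\<close>

lemma osc_fourier:
  fixes f :: "real^('p::finite + 'q::finite) \<Rightarrow> complex"
  assumes f: "integrable lborel f" and ff: "integrable lborel (fourier f)" and t: "t \<noteq> 0"
  shows "osc (fourier f) t = (\<Prod>i\<in>(UNIV::('p+'q) set). of_real (sqrt pi) / csqrt (- \<i> * of_real (t / 2 * quad_sign i))) * osc f (- 1 / t)"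
proof -
  define c where "c e i = of_real e - \<i> * of_real (t / 2 * quad_sign i)" for e and i :: "'p + 'q"
  have [measurable]: "f \<in> borel_measurable borel" "fourier f \<in> borel_measurable borel"
    using f ff by (auto dest: borel_measurable_integrable)
  have cnz: "c e i \<noteq> 0" for e i
    using t quad_sign_cases[of i] by (auto simp: c_def complex_eq_iff)
  have c0: "c 0 i \<notin> \<real>\<^sub>\<le>\<^sub>0" for i
    using t quad_sign_cases[of i] by (auto simp: c_def complex_nonpos_Reals_iff)
  have clim: "((\<lambda>e. c e i) \<longlongrightarrow> c 0 i) (at_right 0)" for i
    unfolding c_def by (auto intro!: tendsto_eq_intros)
  have "((\<lambda>e. LINT x|lborel. exp (- (\<Sum>i\<in>UNIV. c e i * of_real ((x $ i)\<^sup>2))) * fourier f x) \<longlongrightarrow> (LINT x|lborel. exp (- (\<Sum>i\<in>UNIV. c 0 i * of_real ((x $ i)\<^sup>2))) * fourier f x)) (at_right 0)"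
  proof (rule tendsto_LINT_at_within)
    show "integrable lborel (\<lambda>x. norm (fourier f x))" using ff by (rule integrable_norm)
    show "\<forall>\<^sub>F e in at_right 0. \<forall>x\<in>space lborel. norm (exp (- (\<Sum>i\<in>UNIV. c e i * of_real ((x $ i)\<^sup>2))) * fourier f x) \<le> norm (fourier f x)"
      using eventually_at_right_less[of "0::real"]
    proof eventually_elim
      case (elim e)
      have "(\<Sum>i\<in>UNIV. e * (x $ i)\<^sup>2) \<ge> 0" for x :: "real^('p+'q)" using elim by (intro sum_nonneg) auto
      then show ?case by (auto simp: norm_mult c_def intro!: mult_left_le_one_le)
    qed
    show "((\<lambda>e. exp (- (\<Sum>i\<in>UNIV. c e i * of_real ((x $ i)\<^sup>2))) * fourier f x) \<longlongrightarrow> exp (- (\<Sum>i\<in>UNIV. c 0 i * of_real ((x $ i)\<^sup>2))) * fourier f x) (at_right 0)" for x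
      by (intro tendsto_intros clim)
    show "\<forall>\<^sub>F e in at_right 0. (\<lambda>x. exp (- (\<Sum>i\<in>UNIV. c e i * of_real ((x $ i)\<^sup>2))) * fourier f x) \<in> borel_measurable lborel"
      by (intro always_eventually allI) measurable
  qed
  also have "exp (- (\<Sum>i\<in>UNIV. c 0 i * of_real ((x $ i)\<^sup>2))) = iexp (t * (jdet x / 2))" for x
    by (simp add: c_def jdet_eq_sum sum_distrib_left sum_distrib_right sum_divide_distrib sum_negf mult_ac)
  then have "(LINT x|lborel. exp (- (\<Sum>i\<in>UNIV. c 0 i * of_real ((x $ i)\<^sup>2))) * fourier f x) = osc (fourier f) t"
    by (simp add: osc_def)
  finally have lim1: "((\<lambda>e. LINT x|lborel. exp (- (\<Sum>i\<in>UNIV. c e i * of_real ((x $ i)\<^sup>2))) * fourier f x) \<longlongrightarrow> osc (fourier f) t) (at_right 0)" .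
  have "((\<lambda>e. LINT y|lborel. exp (- (\<Sum>i\<in>UNIV. of_real ((y $ i)\<^sup>2) / (4 * c e i))) * f y) \<longlongrightarrow> (LINT y|lborel. exp (- (\<Sum>i\<in>UNIV. of_real ((y $ i)\<^sup>2) / (4 * c 0 i))) * f y)) (at_right 0)"
  proof (rule tendsto_LINT_at_within)
    show "integrable lborel (\<lambda>x. norm (f x))" using f by (rule integrable_norm)
    show "\<forall>\<^sub>F e in at_right 0. \<forall>y\<in>space lborel. norm (exp (- (\<Sum>i\<in>UNIV. of_real ((y $ i)\<^sup>2) / (4 * c e i))) * f y) \<le> norm (f y)"
      using eventually_at_right_less[of "0::real"]
    proof eventually_elim
      case (elim e)
      \<comment> \<open>The reciprocal of a number with positive real part has positive real part,
        so the dual Gaussian is again bounded by 1.\<close>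
      have "(\<Sum>i\<in>UNIV. Re (of_real ((y $ i)\<^sup>2) / (4 * c e i))) \<ge> 0" for y :: "real^('p+'q)"
      proof (rule sum_nonneg)
        fix i
        have "Re (of_real ((y $ i)\<^sup>2) / (4 * c e i)) = (y $ i)\<^sup>2 / 4 * Re (inverse (c e i))"
        proof -
          have "of_real ((y $ i)\<^sup>2) / (4 * c e i) = of_real ((y $ i)\<^sup>2 / 4) * inverse (c e i)"
            using cnz[of e i] by (simp add: field_simps)
          then show ?thesis by (simp only: Re_complex_of_real Im_complex_of_real times_complex.sel)
        qed
        also have "Re (inverse (c e i)) \<ge> 0" using elim by (simp add: c_def)
        then have "(y $ i)\<^sup>2 / 4 * Re (inverse (c e i)) \<ge> 0" by (intro mult_nonneg_nonneg) auto
        finally show "Re (of_real ((y $ i)\<^sup>2) / (4 * c e i)) \<ge> 0" .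
      qed
      then show ?case by (auto simp: norm_mult Re_sum intro!: mult_left_le_one_le simp del: Re_divide_of_real)
    qed
    show "((\<lambda>e. exp (- (\<Sum>i\<in>UNIV. of_real ((y $ i)\<^sup>2) / (4 * c e i))) * f y) \<longlongrightarrow> exp (- (\<Sum>i\<in>UNIV. of_real ((y $ i)\<^sup>2) / (4 * c 0 i))) * f y) (at_right 0)" for y
      by (intro tendsto_mult tendsto_exp tendsto_minus tendsto_sum tendsto_divide tendsto_const clim) (simp add: cnz)
    show "\<forall>\<^sub>F e in at_right 0. (\<lambda>y. exp (- (\<Sum>i\<in>UNIV. of_real ((y $ i)\<^sup>2) / (4 * c e i))) * f y) \<in> borel_measurable lborel"
      by (intro always_eventually allI) measurable
  qed
  also have "(LINT y|lborel. exp (- (\<Sum>i\<in>UNIV. of_real ((y $ i)\<^sup>2) / (4 * c 0 i))) * f y) = osc f (- 1 / t)"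
  proof -
    have "- (of_real ((y $ i)\<^sup>2) / (4 * c 0 i)) = \<i> * of_real (- 1 / t * (quad_sign i * (y $ i)\<^sup>2 / 2))" for y :: "real^('p+'q)" and i
      using quad_sign_cases[of i] t by (auto simp: c_def complex_eq_iff Re_divide Im_divide power2_eq_square field_simps)
    then have "- (\<Sum>i\<in>UNIV. of_real ((y $ i)\<^sup>2) / (4 * c 0 i)) = \<i> * of_real (- 1 / t * (jdet y / 2))" for y
      by (simp only: jdet_eq_sum sum_divide_distrib sum_distrib_left of_real_sum sum_negf[symmetric])
    then show ?thesis by (simp only: osc_def)
  qed
  finally have "((\<lambda>e. (\<Prod>i\<in>UNIV. of_real (sqrt pi) / csqrt (c e i)) * (LINT y|lborel. exp (- (\<Sum>i\<in>UNIV. of_real ((y $ i)\<^sup>2) / (4 * c e i))) * f y))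
      \<longlongrightarrow> (\<Prod>i\<in>UNIV. of_real (sqrt pi) / csqrt (c 0 i)) * osc f (- 1 / t)) (at_right 0)"
    by (intro tendsto_mult tendsto_prod tendsto_divide tendsto_const isCont_tendsto_compose[OF continuous_at_csqrt[OF c0] clim])
      (simp_all add: cnz)
  moreover have "\<forall>\<^sub>F e in at_right 0. (\<Prod>i\<in>UNIV. of_real (sqrt pi) / csqrt (c e i)) * (LINT y|lborel. exp (- (\<Sum>i\<in>UNIV. of_real ((y $ i)\<^sup>2) / (4 * c e i))) * f y) =
      (LINT x|lborel. exp (- (\<Sum>i\<in>UNIV. c e i * of_real ((x $ i)\<^sup>2))) * fourier f x)"
    using eventually_at_right_less[of "0::real"]
  proof eventually_elim
    case (elim e)
    then have "Re (c e i) > 0" for i by (simp add: c_def)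
    from fourier_gaussian_fubini[OF f this] show ?case by simp
  qed
  ultimately have "((\<lambda>e. LINT x|lborel. exp (- (\<Sum>i\<in>UNIV. c e i * of_real ((x $ i)\<^sup>2))) * fourier f x)
      \<longlongrightarrow> (\<Prod>i\<in>UNIV. of_real (sqrt pi) / csqrt (c 0 i)) * osc f (- 1 / t)) (at_right 0)"
    by (rule Lim_transform_eventually)
  from tendsto_unique[OF _ lim1 this] show ?thesis by (simp add: c_def)
qed

text \<open>Every coordinate contributes a root of modulus sqrt (exp x / 2) and a phase of pi/4 up
  to sign. The p positive and the q negative squares contribute opposite phases, which leaves (p -
  q) pi / 4.\<close>

lemma osc_fourier_exp:
  fixes f :: "real^('p::finite + 'q::finite) \<Rightarrow> complex"
  assumes f: "integrable lborel f" and ff: "integrable lborel (fourier f)" and \<sigma>: "\<sigma> = 1 \<or> \<sigma> = - 1"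
  shows "osc (fourier f) (\<sigma> * exp x) =
    of_real (sqrt (2 * pi)) ^ (CARD('p) + CARD('q)) * iexp (\<sigma> * ((real CARD('p) - real CARD('q)) * pi / 4)) *
    exp (- of_real ((real CARD('p) + real CARD('q)) / 2 * x)) * osc f (- \<sigma> * exp (- x))"
proof -
  define r where "r = sqrt (exp x / 2)"
  have r: "r > 0" "r\<^sup>2 = exp x / 2" by (auto simp: r_def)
  have csq: "csqrt (- \<i> * of_real (\<sigma> * exp x / 2 * s)) = of_real r * iexp (- \<sigma> * s * pi / 4)" if s: "s = 1 \<or> s = - 1" for s
  proof -
    define w where "w = of_real r * iexp (- \<sigma> * s * pi / 4)"
    have \<sigma>s: "\<sigma> * s = 1 \<or> \<sigma> * s = - 1" using \<sigma> s by auto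
    have "w\<^sup>2 = of_real (r\<^sup>2) * iexp (- \<sigma> * s * pi / 2)"
      by (simp add: w_def power_mult_distrib mult_ac flip: exp_double)
    also have "iexp (- \<sigma> * s * pi / 2) = - \<i> * of_real (\<sigma> * s)"
      using \<sigma>s \<sigma> s by (auto simp: complex_eq_iff Re_exp Im_exp)
    finally have w2: "w\<^sup>2 = - \<i> * of_real (\<sigma> * exp x / 2 * s)" by (simp add: r)
    \<comment> \<open>The real part is the same for both signs and positive; this singles out
      \<open>w\<close> as the principal root among the two roots of its square.\<close>
    have Rew: "Re w = r * cos (pi / 4)"
      using \<sigma>s \<sigma> s by (auto simp: w_def Re_exp)
    have "Re w > 0" unfolding Rew using r by (intro mult_pos_pos cos_gt_zero) auto
    then have "csqrt (w\<^sup>2) = w" by (intro csqrt_square) auto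
    then show ?thesis unfolding w2 unfolding w_def .
  qed
  have fac: "of_real (sqrt pi) / csqrt (- \<i> * of_real (\<sigma> * exp x / 2 * s)) = of_real (sqrt (2 * pi)) * exp (- of_real (x / 2)) * iexp (s * (\<sigma> * pi / 4))" if s: "s = 1 \<or> s = - 1" for s
  proof -
    have "sqrt pi / r = sqrt (2 * pi) * exp (- (x / 2))"
    proof -
      have "sqrt (exp x) = exp (x / 2)"
        by (rule real_sqrt_unique) (simp_all flip: exp_double)
      then show ?thesis by (simp add: r_def real_sqrt_divide real_sqrt_mult exp_minus field_simps)
    qed
    then have f1: "complex_of_real (sqrt pi) / of_real r = of_real (sqrt (2 * pi)) * exp (- of_real (x / 2))"
      by (metis exp_of_real of_real_divide of_real_minus of_real_mult)
    have f2: "inverse (iexp (- \<sigma> * s * pi / 4)) = iexp (s * (\<sigma> * pi / 4))"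
      by (simp add: mult_ac flip: exp_minus)
    have split: "A / (B * C) = A / B * inverse C" for A B C :: complex by (simp add: field_simps)
    show ?thesis unfolding csq[OF s] split f1 f2 by (rule refl)
  qed
  have "osc (fourier f) (\<sigma> * exp x) = (\<Prod>i\<in>(UNIV::('p+'q) set). of_real (sqrt (2 * pi)) * exp (- of_real (x / 2)) * iexp (quad_sign i * (\<sigma> * pi / 4))) * osc f (- 1 / (\<sigma> * exp x))"
    using \<sigma> by (subst osc_fourier[OF f ff]) (auto simp only: fac[OF quad_sign_cases] mult_eq_0_iff exp_not_eq_zero)
  also have "- 1 / (\<sigma> * exp x) = - \<sigma> * exp (- x)"
    using \<sigma> by (auto simp: exp_minus divide_simps)
  also have "(\<Prod>i\<in>(UNIV::('p+'q) set). of_real (sqrt (2 * pi)) * exp (- of_real (x / 2)) * iexp (quad_sign i * (\<sigma> * pi / 4))) =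
     of_real (sqrt (2 * pi)) ^ (CARD('p) + CARD('q)) * exp (- of_real (x / 2)) ^ (CARD('p) + CARD('q)) * (iexp (\<sigma> * pi / 4) ^ CARD('p) * iexp (- (\<sigma> * pi / 4)) ^ CARD('q))"
    by (simp only: prod_UNIV_Plus quad_sign_simps prod_constant power_mult_distrib power_add mult_1 mult_minus1 mult_ac)
  also have "exp (- complex_of_real (x / 2)) ^ (CARD('p) + CARD('q)) = exp (- of_real ((real CARD('p) + real CARD('q)) / 2 * x))"
    by (subst exp_of_nat_mult[symmetric]) (simp add: mult_ac)
  also have "iexp (\<sigma> * pi / 4) ^ CARD('p) * iexp (- (\<sigma> * pi / 4)) ^ CARD('q) = iexp (\<sigma> * ((real CARD('p) - real CARD('q)) * pi / 4))"
    unfolding exp_of_nat_mult[symmetric] exp_add[symmetric] by (rule arg_cong[of _ _ exp]) (simp add: field_simps)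
  finally show ?thesis by (simp only: mult_ac)
qed

section \<open>Zeta integrals as Mellin transforms\<close>

text \<open>On the null cone \<open>0 powr s\<close> is 0 for every s. Written with
  \<open>exp\<close>, the function is visibly measurable in x and entire in s.\<close>

lemma jdet_pow_eq:
  "jdet_pow \<epsilon> s x = (case \<epsilon> of Plus \<Rightarrow> 1 | Minus \<Rightarrow> of_real (sgn (jdet x))) *
     (if jdet x = 0 then 0 else exp (s * of_real (ln \<bar>jdet x\<bar>)))"
  by (cases \<epsilon>) (auto simp: powr_def Ln_of_real)

lemma jdet_pow_measurable [measurable]: "jdet_pow \<epsilon> s \<in> borel_measurable borel"
proof -
  have "(\<lambda>x. jdet_pow \<epsilon> s x) \<in> borel_measurable borel"
    unfolding jdet_pow_eq by (cases \<epsilon>) (simp_all, measurable)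
  then show ?thesis .
qed

lemma norm_jdet_pow_le:
  assumes "0 \<le> Re s" "Re s \<le> real N"
  shows "norm (jdet_pow \<epsilon> s x) \<le> 1 + 2 ^ N * \<bar>jdet x / 2\<bar> ^ N"
proof -
  define r where "r = \<bar>jdet x\<bar>"
  have r: "r \<ge> 0" by (simp add: r_def)
  have "norm (jdet_pow \<epsilon> s x) \<le> norm (of_real r powr s)"
    by (cases \<epsilon>) (auto simp: r_def norm_mult sgn_if)
  also have "\<dots> = r powr Re s" using r by (simp add: norm_powr_real_powr)
  also have "\<dots> \<le> 1 + r ^ N"
  proof (cases "r \<le> 1")
    case True
    then have "r powr Re s \<le> 1" using r assms by (intro powr_le1) auto
    then show ?thesis using r by (simp add: add_increasing2)
  next
    case False
    then have "r powr Re s \<le> r powr real N" using assms by (intro powr_mono) auto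
    then show ?thesis using False by (simp add: powr_realpow)
  qed
  also have "r ^ N = 2 ^ N * \<bar>jdet x / 2\<bar> ^ N"
    by (simp add: r_def abs_divide power_divide)
  finally show ?thesis .
qed

text \<open>The exponent 0 and the halved \<open>jdet\<close> are kept so that both summands are
  instances of \<open>integrable_jdet_power\<close>.\<close>

lemma zeta_integrand_bound:
  assumes "0 \<le> Re s" "Re s \<le> real N"
  shows "norm (f x * jdet_pow \<epsilon> s x) \<le> \<bar>jdet x / 2\<bar> ^ 0 * norm (f x) + 2 ^ N * (\<bar>jdet x / 2\<bar> ^ N * norm (f x))"
  using mult_left_mono[OF norm_jdet_pow_le[OF assms, of \<epsilon> x], of "norm (f x)"]
  by (simp add: norm_mult distrib_left mult_ac)

lemma zeta_integrand_integrable: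
  assumes mom: "moments_integrable f" and "0 \<le> Re s"
  shows "integrable lborel (\<lambda>x. f x * jdet_pow \<epsilon> s x)"
proof -
  have [measurable]: "f \<in> borel_measurable borel" by (rule moments_meas[OF mom])
  obtain N where N: "Re s \<le> real N" using real_arch_simple by blast
  show ?thesis
  proof (rule Bochner_Integration.integrable_bound)
    show "integrable lborel (\<lambda>x. \<bar>jdet x / 2\<bar> ^ 0 * norm (f x) + 2 ^ N * (\<bar>jdet x / 2\<bar> ^ N * norm (f x)))"
      by (intro Bochner_Integration.integrable_add integrable_mult_right integrable_jdet_power mom)
  qed (use zeta_integrand_bound[OF assms(2) N] in \<open>auto intro!: AE_I2 intro: order.trans[OF _ abs_ge_self]\<close>)
qed

lemma zeta_integral_holomorphic:
  assumes mom: "moments_integrable f"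
  shows "zeta_integral \<epsilon> f holomorphic_on {s. Re s > 0}"
proof -
  have [measurable]: "f \<in> borel_measurable borel" by (rule moments_meas[OF mom])
  have "(\<lambda>s. LINT x|lborel. f x * jdet_pow \<epsilon> s x) holomorphic_on {s. Re s > 0}"
  proof (rule holomorphic_on_LINT)
    show "(\<lambda>s. f x * jdet_pow \<epsilon> s x) holomorphic_on {s. Re s > 0}" for x
      unfolding jdet_pow_eq by (cases "jdet x = 0") (auto intro!: holomorphic_intros)
    fix z0 assume "z0 \<in> {s. Re s > 0}"
    then have z0: "Re z0 > 0" by simp
    define r where "r = Re z0 / 2"
    have r: "r > 0" using z0 by (simp add: r_def)
    obtain N where N: "Re z0 + r \<le> real N" using real_arch_simple by blast
    have Re: "Re z \<ge> r" "Re z \<le> real N" if "z \<in> cball z0 r" for z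
      using that abs_Re_le_cmod[of "z0 - z"] N by (auto simp: dist_norm r_def abs_le_iff)
    show "\<exists>r>0. \<exists>g. integrable lborel g \<and> cball z0 r \<subseteq> {s. Re s > 0} \<and>
      (\<forall>z\<in>cball z0 r. \<forall>x\<in>space lborel. norm (f x * jdet_pow \<epsilon> z x) \<le> g x)"
    proof (intro exI conjI ballI)
      show "integrable lborel (\<lambda>x. \<bar>jdet x / 2\<bar> ^ 0 * norm (f x) + 2 ^ N * (\<bar>jdet x / 2\<bar> ^ N * norm (f x)))"
        by (intro Bochner_Integration.integrable_add integrable_mult_right integrable_jdet_power mom)
      show "cball z0 r \<subseteq> {s. Re s > 0}" using Re r by fastforce
      show "norm (f x * jdet_pow \<epsilon> z x) \<le> \<bar>jdet x / 2\<bar> ^ 0 * norm (f x) + 2 ^ N * (\<bar>jdet x / 2\<bar> ^ N * norm (f x))"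
        if "z \<in> cball z0 r" for z x
        using Re[OF that] r by (intro zeta_integrand_bound) auto
    qed (rule r)
  qed (auto intro!: open_halfspace_Re_gt)
  then show ?thesis unfolding zeta_integral_def[abs_def] .
qed

text \<open>Subtracting \<open>osc f 0\<close> puts the absolutely integrable kernel inside the
  integral over the space. After the exchange of integrals, \<open>LINT_exp_exp_imaginary\<close> is
  applied with \<theta> = \<sigma> * jdet y / 2; the halving produces \<open>2 powr (- s)\<close>,
  and the sign of \<theta> separates the two parities.\<close>

lemma osc_mellin:
  fixes f :: "real^('p::finite + 'q::finite) \<Rightarrow> complex"
  assumes mom: "moments_integrable f" and s: "0 < Re s" "Re s < 1" and \<sigma>: "\<sigma> = 1 \<or> \<sigma> = - 1"
  shows "(LINT x|lborel. exp (- s * of_real x) * (osc f (\<sigma> * exp x) - osc f 0)) =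
    Gamma (- s) * 2 powr (- s) * (cos (of_real pi * s / 2) * zeta_integral Plus f s
       - \<i> * of_real \<sigma> * sin (of_real pi * s / 2) * zeta_integral Minus f s)"
proof -
  have [measurable]: "f \<in> borel_measurable borel" by (rule moments_meas[OF mom])
  define G where "G x y = exp (- s * of_real x) * (iexp (\<sigma> * (jdet y / 2) * exp x) - 1) * f y" for x :: real and y :: "real^('p + 'q)"
  have intG: "integrable (lborel \<Otimes>\<^sub>M lborel) (case_prod G)"
  proof (rule Bochner_Integration.integrable_bound)
    show "integrable (lborel \<Otimes>\<^sub>M lborel) (\<lambda>(x, y). (exp (- Re s * x) * min 2 (exp x)) *
        (\<bar>jdet y / 2\<bar> ^ 0 * norm (f y) + \<bar>jdet y / 2\<bar> ^ 1 * norm (f y)))"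
      by (intro integrable_lborel_times integrable_exp_min s Bochner_Integration.integrable_add integrable_jdet_power mom)
    show "case_prod G \<in> borel_measurable (lborel \<Otimes>\<^sub>M lborel)"
      unfolding G_def by measurable
    \<comment> \<open>The constant max 1 (norm a) is at most 1 plus the absolute value of jdet y /
      2, so the moments of order 0 and 1 suffice for Fubini's theorem.\<close>
    have "norm (G x y) \<le> (exp (- Re s * x) * min 2 (exp x)) * (\<bar>jdet y / 2\<bar> ^ 0 * norm (f y) + \<bar>jdet y / 2\<bar> ^ 1 * norm (f y))" for x y
    proof -
      define a where "a = - \<i> * of_real (\<sigma> * (jdet y / 2))"
      have a: "Re a \<ge> 0" "norm a = \<bar>jdet y / 2\<bar>"
        using \<sigma> by (auto simp: a_def norm_mult)
      have "G x y = exp (- s * of_real x) * (exp (- a * of_real (exp x)) - 1) * f y"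
        by (simp add: G_def a_def mult_ac)
      also have "norm \<dots> \<le> max 1 (norm a) * (exp (- Re s * x) * min 2 (exp x)) * norm (f y)"
        unfolding norm_mult[of _ "f y"] by (intro mult_right_mono norm_exp_exp_bound a) auto
      also have "\<dots> \<le> (1 + \<bar>jdet y / 2\<bar>) * (exp (- Re s * x) * min 2 (exp x)) * norm (f y)"
        unfolding a(2) by (intro mult_right_mono mult_nonneg_nonneg) auto
      finally show ?thesis by (simp add: algebra_simps)
    qed
    then show "AE p in lborel \<Otimes>\<^sub>M lborel. norm (case_prod G p) \<le> norm (case p of (x, y) \<Rightarrow> (exp (- Re s * x) * min 2 (exp x)) *
        (\<bar>jdet y / 2\<bar> ^ 0 * norm (f y) + \<bar>jdet y / 2\<bar> ^ 1 * norm (f y)))"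
      by (intro AE_I2) (auto split: prod.split intro: order.trans[OF _ abs_ge_self])
  qed
  have "(LINT x|lborel. exp (- s * of_real x) * (osc f (\<sigma> * exp x) - osc f 0)) = (LINT x|lborel. LINT y|lborel. G x y)"
  proof (intro Bochner_Integration.integral_cong refl)
    fix x
    have "osc f (\<sigma> * exp x) - osc f 0 = (LINT y|lborel. iexp (\<sigma> * exp x * (jdet y / 2)) * f y - iexp (0 * (jdet y / 2)) * f y)"
      unfolding osc_def by (rule Bochner_Integration.integral_diff[symmetric]) (rule integrable_osc[OF mom])+
    also have "exp (- s * of_real x) * \<dots> = (LINT y|lborel. G x y)"
      unfolding integral_mult_right_zero[symmetric]
      by (intro Bochner_Integration.integral_cong refl) (simp add: G_def algebra_simps)
    finally show "exp (- s * of_real x) * (osc f (\<sigma> * exp x) - osc f 0) = (LINT y|lborel. G x y)" .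
  qed
  also have "\<dots> = (LINT y|lborel. LINT x|lborel. G x y)"
    by (rule lborel_pair.Fubini_integral[OF intG, symmetric])
  also have "\<dots> = (LINT y|lborel. Gamma (- s) * 2 powr (- s) * (cos (of_real pi * s / 2) * (f y * jdet_pow Plus s y)
       - \<i> * of_real \<sigma> * sin (of_real pi * s / 2) * (f y * jdet_pow Minus s y)))"
  proof (intro Bochner_Integration.integral_cong refl)
    fix y :: "real^('p + 'q)"
    define \<theta> where "\<theta> = \<sigma> * (jdet y / 2)"
    have "(LINT x|lborel. G x y) = (LINT x|lborel. exp (- s * of_real x) * (exp (\<i> * of_real \<theta> * of_real (exp x)) - 1)) * f y"
      unfolding G_def \<theta>_def by (simp add: mult_ac)
    also have "\<dots> = Gamma (- s) * (of_real \<bar>\<theta>\<bar> powr s * (cos (of_real pi * s / 2) - \<i> * of_real (sgn \<theta>) * sin (of_real pi * s / 2))) * f y"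
      by (simp only: LINT_exp_exp_imaginary[OF s])
    also have "sgn \<theta> = \<sigma> * sgn (jdet y)" using \<sigma> by (auto simp: \<theta>_def sgn_mult)
    also have "complex_of_real \<bar>\<theta>\<bar> powr s = 2 powr (- s) * of_real \<bar>jdet y\<bar> powr s"
    proof (cases "jdet y = 0")
      case False
      have th: "\<bar>\<theta>\<bar> = \<bar>jdet y\<bar> / 2" using \<sigma> by (auto simp: \<theta>_def abs_mult)
      have L1: "Ln (of_real \<bar>\<theta>\<bar>) = of_real (ln \<bar>jdet y\<bar>) - of_real (ln 2)"
        unfolding th using False by (subst Ln_of_real) (auto simp: ln_div)
      have L2: "Ln (of_real \<bar>jdet y\<bar>) = of_real (ln \<bar>jdet y\<bar>)"
        using False by (intro Ln_of_real) auto
      have L3: "Ln 2 = complex_of_real (ln 2)"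
        using Ln_of_real[of 2] by simp
      have "\<theta> \<noteq> 0" using False th by auto
      then show ?thesis using False
        by (simp add: powr_def L1 L2 L3 algebra_simps flip: exp_add)
    qed (auto simp: \<theta>_def)
    finally show "(LINT x|lborel. G x y) = Gamma (- s) * 2 powr (- s) * (cos (of_real pi * s / 2) * (f y * jdet_pow Plus s y)
       - \<i> * of_real \<sigma> * sin (of_real pi * s / 2) * (f y * jdet_pow Minus s y))"
      by (simp add: algebra_simps)
  qed
  also have "\<dots> = Gamma (- s) * 2 powr (- s) * (cos (of_real pi * s / 2) * zeta_integral Plus f s
       - \<i> * of_real \<sigma> * sin (of_real pi * s / 2) * zeta_integral Minus f s)"
    unfolding zeta_integral_def integral_mult_right_zero using s zeta_integrand_integrable[OF mom, of s]
    by (subst Bochner_Integration.integral_diff) (auto simp del: jdet_pow.simps)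
  finally show ?thesis .
qed

text \<open>Only the duality relation is kept of the Fourier transform. It is symmetric in
  \<open>f\<close> and \<open>h\<close> up to inverting \<open>K\<close> (\<open>swap\<close>), so
  whatever is proved for \<open>f\<close> also holds for \<open>h\<close>; this takes the place of
  Fourier inversion.\<close>

locale osc_dual =
  fixes f h :: "real^('p::finite + 'q::finite) \<Rightarrow> complex" and K :: complex and \<alpha> \<nu> :: real
  assumes mom_f: "moments_integrable f" and mom_h: "moments_integrable h"
    and K: "K \<noteq> 0" and \<nu>: "\<nu> > 0"
    and dual: "\<And>\<sigma> x. \<sigma> = 1 \<or> \<sigma> = - 1 \<Longrightarrow>
      osc h (\<sigma> * exp x) = K * iexp (\<sigma> * \<alpha>) * exp (- of_real (\<nu> * x)) * osc f (- \<sigma> * exp (- x))"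
begin

text \<open>Apply the relation at (- \<sigma>, - x) and solve for the term in \<open>f\<close>. The
  phase changes sign twice and the exponential returns to its original form, so only
  \<open>K\<close> is inverted.\<close>

lemma swap: "osc_dual h f (inverse K) \<alpha> \<nu>"
proof
  fix \<sigma> x :: real assume "\<sigma> = 1 \<or> \<sigma> = - 1"
  then have "osc h (- \<sigma> * exp (- x)) = K * iexp (- \<sigma> * \<alpha>) * exp (- of_real (\<nu> * - x)) * osc f (- (- \<sigma>) * exp (- (- x)))"
    by (intro dual) auto
  then show "osc f (\<sigma> * exp x) = inverse K * iexp (\<sigma> * \<alpha>) * exp (- of_real (\<nu> * x)) * osc h (- \<sigma> * exp (- x))"
    using K by (simp add: exp_minus field_simps)
qed (use mom_f mom_h K \<nu> in auto)

text \<open>The Mellin transform of \<open>t \<mapsto> osc f (\<sigma> * t)\<close>, \<open>t = exp x\<close>: the first summand continues the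
  integral over \<open>x \<le> 0\<close>, the second is the integral over \<open>x \<ge> 0\<close> folded back by the duality.\<close>

definition mellin :: "real \<Rightarrow> complex \<Rightarrow> complex" where
  "mellin \<sigma> u = laplace_cont (\<lambda>x. osc f (\<sigma> * exp x)) (\<lambda>k. osc_coeff f k * of_real \<sigma> ^ k) u +
     inverse K * iexp (\<sigma> * \<alpha>) *
     laplace_cont (\<lambda>x. osc h (- \<sigma> * exp x)) (\<lambda>k. osc_coeff h k * of_real (- \<sigma>) ^ k) (of_real \<nu> - u)"

lemma mellin_meromorphic:
  assumes "\<bar>\<sigma>\<bar> = 1"
  shows "mellin \<sigma> meromorphic_on UNIV"
proof -
  have "(\<lambda>u. laplace_cont (\<lambda>x. osc h (- \<sigma> * exp x)) (\<lambda>k. osc_coeff h k * of_real (- \<sigma>) ^ k) (of_real \<nu> - u)) meromorphic_on UNIV"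
  proof (rule meromorphic_on_compose[where f = "\<lambda>u. of_real \<nu> - u" and A = UNIV])
    show "laplace_cont (\<lambda>x. osc h (- \<sigma> * exp x)) (\<lambda>k. osc_coeff h k * of_real (- \<sigma>) ^ k) meromorphic_on UNIV"
      by (rule laplace_cont_meromorphic[OF osc_expands[OF mom_h]]) (simp add: assms)
  qed (auto intro!: analytic_intros)
  moreover have "laplace_cont (\<lambda>x. osc f (\<sigma> * exp x)) (\<lambda>k. osc_coeff f k * of_real \<sigma> ^ k) meromorphic_on UNIV"
    by (rule laplace_cont_meromorphic[OF osc_expands[OF mom_f assms]])
  ultimately show ?thesis
    unfolding mellin_def[abs_def]
    by (intro meromorphic_on_add meromorphic_on_mult meromorphic_on_const)
qed

text \<open>At u = - s the half-line x <= 0 needs truncation order 1, which contributes - osc f 0 /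
  s. The folded half-line needs order 0, but restoring the subtracted constant there contributes +
  osc f 0 / s. The two terms cancel, and what remains is one integral over the whole line.\<close>

lemma mellin_strip:
  assumes s: "0 < Re s" "Re s < 1" and \<sigma>: "\<sigma> = 1 \<or> \<sigma> = - 1"
  shows "mellin \<sigma> (- s) = (LINT x|lborel. exp (- s * of_real x) * (osc f (\<sigma> * exp x) - osc f 0))"
proof -
  have \<sigma>': "\<bar>\<sigma>\<bar> = 1" "\<bar>- \<sigma>\<bar> = 1" using \<sigma> by auto
  define F where "F x = exp (- s * of_real x) * (osc f (\<sigma> * exp x) - osc f 0)" for x
  have s0: "s \<noteq> 0" using s by auto
  note ef = osc_expands[OF mom_f \<sigma>'(1)] and eh = osc_expands[OF mom_h \<sigma>'(2)]
  have [measurable]: "(\<lambda>x. osc f (\<sigma> * exp x)) \<in> borel_measurable borel" by (rule expands_meas[OF ef])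
  have [measurable]: "F \<in> borel_measurable borel" unfolding F_def by measurable
  have i1: "set_integrable lborel {..0} F"
    using set_integrable_laplace_tail[OF ef, of 1 "- s"] s
    by (simp add: F_def[abs_def] osc_coeff_0[OF mom_f])
  have A: "laplace_cont (\<lambda>x. osc f (\<sigma> * exp x)) (\<lambda>k. osc_coeff f k * of_real \<sigma> ^ k) (- s) =
      - osc f 0 / s + (LINT x:{..0}|lborel. F x)"
    using s by (subst laplace_cont_eq_trunc[OF ef, of 1])
      (auto simp: laplace_trunc_def laplace_tail_def F_def[abs_def] osc_coeff_0[OF mom_f])
  \<comment> \<open>The factor exp (\<nu> x) absorbs the exponential in the duality, so the
    integrand for \<open>h\<close> becomes the reflected integrand for \<open>f\<close> without its
    subtraction.\<close>
  have conv: "exp ((of_real \<nu> + s) * of_real x) * osc h (- \<sigma> * exp x) = K * iexp (- \<sigma> * \<alpha>) * (F (- x) + osc f 0 * exp (s * of_real x))" for x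
  proof -
    have 1: "osc h (- \<sigma> * exp x) = K * iexp (- \<sigma> * \<alpha>) * exp (- of_real (\<nu> * x)) * osc f (- (- \<sigma>) * exp (- x))"
      using \<sigma> by (intro dual) auto
    have 2: "exp ((of_real \<nu> + s) * of_real x) * exp (- of_real (\<nu> * x)) = exp (s * complex_of_real x)"
      by (simp add: algebra_simps flip: exp_add)
    have 3: "F (- x) + osc f 0 * exp (s * of_real x) = exp (s * of_real x) * osc f (\<sigma> * exp (- x))"
      by (simp add: F_def algebra_simps)
    have 4: "F (- x) + osc f 0 * exp (s * of_real x) = exp ((of_real \<nu> + s) * of_real x) * exp (- of_real (\<nu> * x)) * osc f (\<sigma> * exp (- x))"
      unfolding 2 by (rule 3)
    show ?thesis unfolding 1 4 minus_minus by (simp only: mult_ac)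
  qed
  have nz: "K * iexp (- \<sigma> * \<alpha>) \<noteq> 0" using K by simp
  have i2: "set_integrable lborel {..0} (\<lambda>x. K * iexp (- \<sigma> * \<alpha>) * (F (- x) + osc f 0 * exp (s * of_real x)))"
    unfolding conv[symmetric] using set_integrable_laplace_tail[OF eh, of 0 "of_real \<nu> + s"] s \<nu> by simp
  have i3: "set_integrable lborel {..0} (\<lambda>x. osc f 0 * exp (s * of_real x))"
    by (intro set_integrable_mult_right set_integrable_cexp_half_line s)
  have i4: "set_integrable lborel {..0} (\<lambda>x. F (- x))"
  proof -
    have "set_integrable lborel {..0} (\<lambda>x. F (- x) + osc f 0 * exp (s * of_real x))"
      using i2 nz by (simp add: set_integrable_mult_right_iff)
    from set_integral_diff(1)[OF this i3] show ?thesis by simp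
  qed
  have B: "laplace_cont (\<lambda>x. osc h (- \<sigma> * exp x)) (\<lambda>k. osc_coeff h k * of_real (- \<sigma>) ^ k) (of_real \<nu> + s) =
      K * iexp (- \<sigma> * \<alpha>) * ((LINT x:{..0}|lborel. F (- x)) + osc f 0 / s)"
  proof -
    have "laplace_cont (\<lambda>x. osc h (- \<sigma> * exp x)) (\<lambda>k. osc_coeff h k * of_real (- \<sigma>) ^ k) (of_real \<nu> + s) =
       (LINT x:{..0}|lborel. K * iexp (- \<sigma> * \<alpha>) * (F (- x) + osc f 0 * exp (s * of_real x)))"
      unfolding conv[symmetric] using s \<nu>
      by (subst laplace_cont_eq_trunc[OF eh, of 0]) (simp_all add: laplace_trunc_def laplace_tail_def)
    also have "\<dots> = K * iexp (- \<sigma> * \<alpha>) * (LINT x:{..0}|lborel. F (- x) + osc f 0 * exp (s * of_real x))"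
      by (rule set_integral_mult_right)
    also have "(LINT x:{..0}|lborel. F (- x) + osc f 0 * exp (s * of_real x)) = (LINT x:{..0}|lborel. F (- x)) + osc f 0 * (1 / s)"
      by (simp only: set_integral_add(2)[OF i4 i3] set_integral_mult_right LINT_cexp_half_line[OF s(1)])
    finally show ?thesis by simp
  qed
  have inv: "inverse K * iexp (\<sigma> * \<alpha>) * (K * iexp (- \<sigma> * \<alpha>)) = 1"
    using K by (simp add: exp_minus field_simps)
  have canc: "inverse K * iexp (\<sigma> * \<alpha>) * (K * iexp (- \<sigma> * \<alpha>) * Z) = Z" for Z
  proof -
    have "inverse K * iexp (\<sigma> * \<alpha>) * (K * iexp (- \<sigma> * \<alpha>) * Z) = inverse K * iexp (\<sigma> * \<alpha>) * (K * iexp (- \<sigma> * \<alpha>)) * Z"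
      by (simp only: mult.assoc)
    then show ?thesis unfolding inv by simp
  qed
  have "mellin \<sigma> (- s) = (- osc f 0 / s + (LINT x:{..0}|lborel. F x)) +
      inverse K * iexp (\<sigma> * \<alpha>) * (K * iexp (- \<sigma> * \<alpha>) * ((LINT x:{..0}|lborel. F (- x)) + osc f 0 / s))"
    by (simp only: mellin_def A B diff_minus_eq_add)
  also have "\<dots> = (LINT x:{..0}|lborel. F x) + (LINT x:{..0}|lborel. F (- x))"
    unfolding canc by simp
  also have "\<dots> = (LINT x|lborel. F x)"
  proof -
    have "(LINT x:{..0}|lborel. F (- x)) = \<bar>-1\<bar> *\<^sub>R (LINT x|lborel. indicator {..0} (0 + (-1) * x) *\<^sub>R F (- (0 + (-1) * x)))"
      unfolding set_lebesgue_integral_def by (rule lborel_integral_real_affine) simp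
    then have r: "(LINT x:{..0}|lborel. F (- x)) = (LINT x|lborel. indicator {..0} (- x) *\<^sub>R F x)"
      by simp
    have ir: "integrable lborel (\<lambda>x. indicator {..0} (- x) *\<^sub>R F x)"
      using lborel_integrable_real_affine[OF i4[unfolded set_integrable_def], of "- 1" 0] by simp
    have "(LINT x:{..0}|lborel. F x) + (LINT x:{..0}|lborel. F (- x)) = (LINT x|lborel. indicator {..0} x *\<^sub>R F x + indicator {..0} (- x) *\<^sub>R F x)"
      unfolding r using i1 ir by (simp add: set_lebesgue_integral_def set_integrable_def)
    also have "\<dots> = (LINT x|lborel. F x)"
    proof (rule integral_cong_AE)
      show "AE x in lborel. indicator {..0} x *\<^sub>R F x + indicator {..0} (- x) *\<^sub>R F x = F x"
        using AE_lborel_singleton[of "0::real"] by eventually_elim (auto simp: indicator_def)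
    qed auto
    finally show ?thesis .
  qed
  finally show ?thesis by (simp add: F_def)
qed

end

section \<open>Meromorphic continuation of the zeta integrals\<close>

lemma cosparse_not_Ints: "\<forall>\<^sub>\<approx>s\<in>UNIV. (s::complex) \<notin> \<int>"
proof (subst eventually_cosparse_open_eq, simp, intro ballI)
  fix x :: complex
  \<comment> \<open>All integers except possibly x itself are removed, so the argument is the same
    whether or not x is an integer.\<close>
  have "open (- (of_int ` {n. of_int n \<noteq> x}) :: complex set)"
    by (simp add: closed_of_int_image open_Compl)
  then have "\<forall>\<^sub>F z in at x. z \<in> - (of_int ` {n. of_int n \<noteq> x}) - {x}"
    by (intro eventually_at_in_open) auto
  then show "\<forall>\<^sub>F z in at x. z \<notin> \<int>"
    by eventually_elim (auto simp: Ints_def)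
qed

lemma cosparse_reflect:
  assumes "\<forall>\<^sub>\<approx>s\<in>UNIV. P (s::complex)"
  shows "\<forall>\<^sub>\<approx>s\<in>UNIV. P (- s - a)"
proof (subst eventually_cosparse_open_eq, simp, intro ballI)
  fix x :: complex
  have P: "\<forall>\<^sub>F z in at (- x - a). P z"
    using assms by (auto simp: eventually_cosparse_open_eq)
  have "filterlim (\<lambda>s. - s - a) (at (- x - a)) (at x)"
    unfolding filterlim_at
    by (auto intro!: tendsto_eq_intros eventually_mono[OF eventually_neq_at_within[of x]])
  then show "\<forall>\<^sub>F z in at x. P (- z - a)"
    using P by (rule eventually_compose_filterlim[rotated])
qed

text \<open>Values at singularities are arbitrary for \<open>meromorphic_on\<close>, so agreement
  can be expected only off a discrete set. The difference is first normalised by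
  \<open>remove_sings\<close>, and the identity theorem for nicely meromorphic functions then makes
  it 0.\<close>

lemma meromorphic_identity:
  assumes F: "F meromorphic_on A" and H: "H meromorphic_on A" and A: "open A" "connected A" "z \<in> A"
    and eq: "\<forall>\<^sub>F w in at z. F w = H w"
  shows "\<forall>\<^sub>\<approx>w\<in>A. F w = H w"
proof -
  have D: "(\<lambda>w. F w - H w) meromorphic_on A" by (intro meromorphic_on_diff F H)
  have rs: "\<forall>\<^sub>\<approx>w\<in>A. remove_sings (\<lambda>w. F w - H w) w = F w - H w"
    by (rule eventually_remove_sings_eq[OF D])
  have "\<forall>\<^sub>F w in at z. remove_sings (\<lambda>w. F w - H w) w = 0"
    using eq eventually_cosparse_imp_eventually_at[OF rs A(3)] by eventually_elim simp
  then have "\<exists>\<^sub>F w in at z. remove_sings (\<lambda>w. F w - H w) w = 0"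
    by (rule eventually_frequently[rotated]) simp
  from frequently_eq_meromorphic_imp_constant[OF this remove_sings_nicely_meromorphic[OF D] A]
  have "remove_sings (\<lambda>w. F w - H w) w = 0" if "w \<in> A" for w using that by blast
  then show ?thesis
    using rs eventually_in_cosparse[OF subset_refl A(1)] by (auto elim: eventually_elim2)
qed

lemma remove_sings_nicely_meromorphic_eq:
  assumes "F nicely_meromorphic_on A" "z \<in> A"
  shows "remove_sings F z = F z"
  using assms unfolding nicely_meromorphic_on_def
  by (metis remove_sings_at_pole remove_sings_eqI)

text \<open>This evaluates the \<open>THE\<close> in \<open>zeta\<close>. Agreement on the strip
  spreads to Re s > 0 because \<open>G\<close> is holomorphic there, and \<open>remove_sings\<close>
  takes the limit value at each point. Uniqueness uses that a nicely meromorphic function is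
  determined by its values off a discrete set.\<close>

lemma meromorphic_continuation_unique:
  assumes F: "F meromorphic_on UNIV" and G: "G holomorphic_on {s. Re s > 0}"
    and eq: "\<And>s. 0 < Re s \<Longrightarrow> Re s < 1 \<Longrightarrow> F s = G s"
  shows "(THE H. H nicely_meromorphic_on UNIV \<and> (\<forall>s. Re s > 0 \<longrightarrow> H s = G s)) = remove_sings F"
proof (rule the_equality)
  define U where "U = {s. Re s > 0}"
  have U: "open U" "connected U" "1/2 \<in> U"
    unfolding U_def by (auto intro: open_halfspace_Re_gt convex_connected convex_halfspace_Re_gt)
  have strip: "\<forall>\<^sub>F s in at (1/2). s \<in> {s. 0 < Re s \<and> Re s < 1}"
  proof (rule eventually_at_in_open')
    show "open {s. 0 < Re s \<and> Re s < 1}"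
      by (intro open_Collect_conj open_halfspace_Re_gt open_halfspace_Re_lt)
  qed auto
  have ev: "\<forall>\<^sub>F s in at (1/2). F s = G s"
    using strip by eventually_elim (use eq in auto)
  have "G analytic_on U" using G U by (simp add: analytic_on_open U_def)
  then have "G meromorphic_on U" by (rule analytic_on_imp_meromorphic_on)
  moreover have "F meromorphic_on U" using F by (rule meromorphic_on_subset) simp
  ultimately have FG: "\<forall>\<^sub>\<approx>s\<in>U. F s = G s"
    using meromorphic_identity[of F U G "1/2"] U ev by blast
  have "remove_sings F s = G s" if "Re s > 0" for s
  proof (rule remove_sings_eqI)
    have s: "s \<in> U" using that by (simp add: U_def)
    have "continuous_on U G" using G unfolding U_def by (rule holomorphic_on_imp_continuous_on)
    then have "isCont G s" using s U by (simp add: continuous_on_eq_continuous_at)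
    then have "G \<midarrow>s\<rightarrow> G s" by (rule isContD)
    moreover have "\<forall>\<^sub>F w in at s. G w = F w"
      using eventually_cosparse_imp_eventually_at[OF FG s] by eventually_elim simp
    ultimately show "F \<midarrow>s\<rightarrow> G s" by (rule Lim_transform_eventually)
  qed
  then show "remove_sings F nicely_meromorphic_on UNIV \<and> (\<forall>s. 0 < Re s \<longrightarrow> remove_sings F s = G s)"
    using remove_sings_nicely_meromorphic[OF F] by blast
  fix H assume H: "H nicely_meromorphic_on UNIV \<and> (\<forall>s. 0 < Re s \<longrightarrow> H s = G s)"
  have "\<forall>\<^sub>F s in at (1/2). H s = F s"
    using strip by eventually_elim (use eq H in auto)
  then have HF: "\<forall>\<^sub>\<approx>s\<in>UNIV. H s = F s"
    using H F by (intro meromorphic_identity[where z = "1/2"]) (auto simp: nicely_meromorphic_on_def)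
  show "H = remove_sings F"
  proof
    fix s
    have "H s = remove_sings H s" using H by (simp add: remove_sings_nicely_meromorphic_eq[of _ UNIV])
    also have "\<dots> = remove_sings F s"
      using HF by (intro remove_sings_cong) (auto simp: eventually_cosparse_open_eq)
    finally show "H s = remove_sings F s" .
  qed
qed

text \<open>These are the quantities by which the linear system for the zeta integrals is divided.
  Since \<open>Gamma\<close> takes the value 0 at its poles, the last claim also says that - s is
  not a pole.\<close>

lemma not_Ints_trig:
  assumes "(s::complex) \<notin> \<int>"
  shows "sin (of_real pi * s / 2) \<noteq> 0" "cos (of_real pi * s / 2) \<noteq> 0" "sin (of_real pi * s) \<noteq> 0"
    "Gamma (- s) \<noteq> 0"
proof -
  show *: "sin (of_real pi * s) \<noteq> 0"
  proof
    assume "sin (of_real pi * s) = 0"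
    then obtain n :: int where "of_real pi * s = of_real (of_int n * pi)"
      using sin_eq_0 by auto
    then have "s = of_int n" by simp
    with assms show False by simp
  qed
  have "sin (of_real pi * s) = 2 * sin (of_real pi * s / 2) * cos (of_real pi * s / 2)"
    using sin_double[of "of_real pi * s / 2"] by simp
  with * show "sin (of_real pi * s / 2) \<noteq> 0" "cos (of_real pi * s / 2) \<noteq> 0" by auto
  show "Gamma (- s) \<noteq> 0"
    using assms nonpos_Ints_Int[of "- s"] by (auto simp: Gamma_eq_zero_iff)
qed

lemma strip_not_Ints:
  assumes "0 < Re s" "Re s < 1"
  shows "s \<notin> \<int>"
proof
  assume "s \<in> \<int>"
  then obtain n where "s = of_int n" by (auto elim: Ints_cases)
  then have "0 < n" "real_of_int n < real_of_int 1" using assms by auto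
  then show False by (simp only: of_int_less_iff)
qed

section \<open>The zeta integrals as combinations of continued Mellin transforms\<close>

context osc_dual
begin

text \<open>The solution of the linear system of \<open>osc_mellin\<close> for the two zeta integrals.\<close>

definition zeta_cont :: "parity \<Rightarrow> complex \<Rightarrow> complex" where
  "zeta_cont \<epsilon> s = (case \<epsilon> of
     Plus \<Rightarrow> 2 powr s * rGamma (- s) * (mellin 1 (- s) + mellin (- 1) (- s)) / (2 * cos (of_real pi * s / 2))
   | Minus \<Rightarrow> \<i> * 2 powr s * rGamma (- s) * (mellin 1 (- s) - mellin (- 1) (- s)) / (2 * sin (of_real pi * s / 2)))"

lemma zeta_cont_meromorphic: "zeta_cont \<epsilon> meromorphic_on UNIV"
proof -
  have m: "(\<lambda>s. mellin \<sigma> (- s)) meromorphic_on UNIV" if "\<bar>\<sigma>\<bar> = 1" for \<sigma>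
    by (rule meromorphic_on_compose[where f = uminus and A = UNIV])
      (auto intro!: mellin_meromorphic[OF that] analytic_intros)
  have a: "(\<lambda>s. 2 powr s) meromorphic_on UNIV" "(\<lambda>s. rGamma (- s)) meromorphic_on UNIV"
     "(\<lambda>s. cos (of_real pi * s / 2)) meromorphic_on UNIV" "(\<lambda>s. sin (of_real pi * s / 2)) meromorphic_on UNIV"
    by (intro analytic_on_imp_meromorphic_on; simp add: analytic_on_open; intro holomorphic_intros; simp)+
  show ?thesis
    unfolding zeta_cont_def[abs_def]
    by (cases \<epsilon>) (simp_all, (intro meromorphic_on_add meromorphic_on_diff meromorphic_on_mult
        meromorphic_on_divide meromorphic_on_const a m; simp)+)
qed

text \<open>Adding the equations for \<sigma> = 1 and \<sigma> = - 1 removes the sine term,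
  subtracting them removes the cosine term; the strip contains no integers, so the divisions are
  legitimate.\<close>

lemma zeta_cont_strip:
  assumes s: "0 < Re s" "Re s < 1"
  shows "zeta_cont \<epsilon> s = zeta_integral \<epsilon> f s"
proof -
  note nz = not_Ints_trig[OF strip_not_Ints[OF s]]
  have m: "mellin \<sigma> (- s) = Gamma (- s) * 2 powr (- s) * (cos (of_real pi * s / 2) * zeta_integral Plus f s
       - \<i> * of_real \<sigma> * sin (of_real pi * s / 2) * zeta_integral Minus f s)" if "\<sigma> = 1 \<or> \<sigma> = - 1" for \<sigma>
    using mellin_strip[OF s that] osc_mellin[OF mom_f s that] by simp
  have p: "2 powr s * 2 powr (- s) = (1::complex)" by (simp flip: powr_add)
  have g: "rGamma (- s) * Gamma (- s) = 1" using nz by (simp add: rGamma_inverse_Gamma)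
  show ?thesis
  proof (cases \<epsilon>)
    case Plus
    have "zeta_cont Plus s = (2 powr s * 2 powr (- s)) * (rGamma (- s) * Gamma (- s)) * (2 * cos (of_real pi * s / 2) * zeta_integral Plus f s) / (2 * cos (of_real pi * s / 2))"
      by (simp add: zeta_cont_def m algebra_simps)
    then show ?thesis using nz Plus by (simp add: p g)
  next
    case Minus
    have "zeta_cont Minus s = (2 powr s * 2 powr (- s)) * (rGamma (- s) * Gamma (- s)) * (2 * sin (of_real pi * s / 2) * zeta_integral Minus f s) / (2 * sin (of_real pi * s / 2))"
      by (simp add: zeta_cont_def m algebra_simps)
    then show ?thesis using nz Minus by (simp add: p g)
  qed
qed

text \<open>The exceptional set cannot simply be dropped: where \<open>zeta_cont\<close> divides by
  zero it takes a default value, while \<open>zeta\<close> has its removable singularities filled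
  in.\<close>

lemma zeta_eq_zeta_cont: "\<forall>\<^sub>\<approx>s\<in>UNIV. zeta \<epsilon> f s = zeta_cont \<epsilon> s"
proof -
  have "zeta \<epsilon> f = remove_sings (zeta_cont \<epsilon>)"
    unfolding zeta_def
    by (intro meromorphic_continuation_unique zeta_cont_meromorphic zeta_integral_holomorphic mom_f zeta_cont_strip)
  then show ?thesis using eventually_remove_sings_eq[OF zeta_cont_meromorphic] by simp
qed

end

section \<open>The functional equations\<close>

lemma osc_dual_fourier:
  fixes f :: "real^('p::finite + 'q::finite) \<Rightarrow> complex"
  assumes "schwartz f"
  shows "osc_dual f (fourier f) (of_real (sqrt (2 * pi)) ^ (CARD('p) + CARD('q)))
    ((real CARD('p) - real CARD('q)) * pi / 4) ((real CARD('p) + real CARD('q)) / 2)"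
proof
  fix \<sigma> x :: real assume "\<sigma> = 1 \<or> \<sigma> = - 1"
  then show "osc (fourier f) (\<sigma> * exp x) =
    of_real (sqrt (2 * pi)) ^ (CARD('p) + CARD('q)) * iexp (\<sigma> * ((real CARD('p) - real CARD('q)) * pi / 4)) *
    exp (- of_real ((real CARD('p) + real CARD('q)) / 2 * x)) * osc f (- \<sigma> * exp (- x))"
    by (intro osc_fourier_exp moments_integrable_imp_integrable schwartz_moments_integrable
        schwartz_fourier_moments_integrable assms)
qed (auto intro: schwartz_moments_integrable schwartz_fourier_moments_integrable assms add_pos_pos)

text \<open>The Mellin transforms of \<open>h\<close> at - s are those of \<open>f\<close> at s +
  \<nu> with opposite sign and a phase. Their sum and difference are read back as zeta functions of
  \<open>f\<close> at - s - \<nu>, the phase mixes the two parities through cos \<alpha> and sin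
  \<alpha>, and the reflection formula turns \<open>rGamma (- s)\<close> into
  \<open>Gamma (s + 1)\<close>.\<close>

lemma (in osc_dual) zeta_cont_functional_equation:
  defines "X \<equiv> \<lambda>s. K * (2 powr s * 2 powr (s + of_real \<nu>)) * Gamma (s + 1) * Gamma (s + of_real \<nu>) / of_real pi"
  assumes s: "s \<notin> \<int>" "- s - of_real \<nu> \<notin> \<int>"
  defines "a \<equiv> of_real pi * s / 2" and "b \<equiv> of_real pi * (s + of_real \<nu>) / 2"
  shows "osc_dual.zeta_cont h f (inverse K) \<alpha> \<nu> Plus s =
      X s * (- (2 * sin a * cos b * cos (of_real \<alpha>)) * zeta_cont Plus (- s - of_real \<nu>)
        - 2 * sin a * sin b * sin (of_real \<alpha>) * zeta_cont Minus (- s - of_real \<nu>))"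
    and "osc_dual.zeta_cont h f (inverse K) \<alpha> \<nu> Minus s =
      X s * (2 * cos a * cos b * sin (of_real \<alpha>) * zeta_cont Plus (- s - of_real \<nu>)
        - 2 * cos a * sin b * cos (of_real \<alpha>) * zeta_cont Minus (- s - of_real \<nu>))"
proof -
  interpret D: osc_dual h f "inverse K" \<alpha> \<nu> by (rule swap)
  define M where "M \<sigma> = mellin \<sigma> (s + of_real \<nu>)" for \<sigma>
  define G where "G = Gamma (s + of_real \<nu>) * 2 powr (s + of_real \<nu>)"
  define Zp where "Zp = zeta_cont Plus (- s - of_real \<nu>)"
  define Zm where "Zm = zeta_cont Minus (- s - of_real \<nu>)"
  note nz = not_Ints_trig[OF s(1)]
  note nz' = not_Ints_trig[OF s(2)]
  \<comment> \<open>The angle at the reflected point is - b. The cosine is even and the sine odd, so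
    a minus sign appears in \<open>Mdiff\<close> but not in \<open>Msum\<close>.\<close>
  have b': "of_real pi * (- s - of_real \<nu>) / 2 = - b" by (simp add: b_def field_simps)
  have cb: "cos b \<noteq> 0" "sin b \<noteq> 0" using nz'(1,2) unfolding b' by auto
  have ca: "cos a \<noteq> 0" "sin a \<noteq> 0" using nz(1,2) by (auto simp: a_def)
  have neg: "- (- s - of_real \<nu>) = s + of_real \<nu>" by simp
  have gz: "Gamma (s + of_real \<nu>) \<noteq> 0" using nz'(4) unfolding neg .
  have pw: "2 powr (- s - of_real \<nu>) * 2 powr (s + of_real \<nu>) = (1::complex)"
    by (simp flip: powr_add)
  have Rg: "rGamma (s + of_real \<nu>) * Gamma (s + of_real \<nu>) = 1"
    using gz by (simp add: rGamma_inverse_Gamma)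
  have one: "2 powr (- s - of_real \<nu>) * rGamma (s + of_real \<nu>) * G = 1"
  proof -
    have "2 powr (- s - of_real \<nu>) * rGamma (s + of_real \<nu>) * G =
      (2 powr (- s - of_real \<nu>) * 2 powr (s + of_real \<nu>)) * (rGamma (s + of_real \<nu>) * Gamma (s + of_real \<nu>))"
      by (simp only: G_def mult_ac)
    then show ?thesis unfolding pw Rg by simp
  qed
  have Msum: "M 1 + M (- 1) = 2 * cos b * G * Zp"
  proof -
    have "Zp * (2 * cos b) = 2 powr (- s - of_real \<nu>) * rGamma (s + of_real \<nu>) * (M 1 + M (- 1))"
      unfolding Zp_def zeta_cont_def parity.case b' neg M_def using cb by simp
    then have "2 * cos b * G * Zp = (2 powr (- s - of_real \<nu>) * rGamma (s + of_real \<nu>) * G) * (M 1 + M (- 1))"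
      by (simp add: mult_ac)
    then show ?thesis unfolding one by simp
  qed
  have Mdiff: "\<i> * (M 1 - M (- 1)) = - 2 * sin b * G * Zm"
  proof -
    have eq: "Zm * (- 2 * sin b) = 2 powr (- s - of_real \<nu>) * rGamma (s + of_real \<nu>) * (\<i> * (M 1 - M (- 1)))"
      unfolding Zm_def zeta_cont_def parity.case b' neg M_def using cb by simp
    have "- 2 * sin b * G * Zm = G * (Zm * (- 2 * sin b))" by (simp add: mult_ac)
    also have "\<dots> = (2 powr (- s - of_real \<nu>) * rGamma (s + of_real \<nu>) * G) * (\<i> * (M 1 - M (- 1)))"
      unfolding eq by (simp only: mult_ac)
    finally have "- 2 * sin b * G * Zm = (2 powr (- s - of_real \<nu>) * rGamma (s + of_real \<nu>) * G) * (\<i> * (M 1 - M (- 1)))" .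
    then show ?thesis unfolding one by simp
  qed
  \<comment> \<open>Both Mellin transforms consist of the same two \<open>laplace_cont\<close> terms
    in opposite order, as \<open>\<nu> - (s + \<nu>)\<close> is - s; only the constant in front
    differs.\<close>
  have M': "D.mellin \<sigma> (- s) = K * iexp (\<sigma> * \<alpha>) * M (- \<sigma>)" for \<sigma>
  proof -
    have e: "K * iexp (\<sigma> * \<alpha>) * (inverse K * iexp (- \<sigma> * \<alpha>)) = 1"
      using K by (simp add: exp_minus field_simps)
    have "K * iexp (\<sigma> * \<alpha>) * (A + inverse K * iexp (- \<sigma> * \<alpha>) * B) = K * iexp (\<sigma> * \<alpha>) * A + (K * iexp (\<sigma> * \<alpha>) * (inverse K * iexp (- \<sigma> * \<alpha>))) * B" for A B
      by (simp only: distrib_left mult.assoc)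
    then show ?thesis
      unfolding M_def mellin_def D.mellin_def e by (simp add: add.commute)
  qed
  have e1: "iexp (1 * \<alpha>) = cos (of_real \<alpha>) + \<i> * sin (of_real \<alpha>)"
    "iexp (- 1 * \<alpha>) = cos (of_real \<alpha>) - \<i> * sin (of_real \<alpha>)"
    using exp_Euler[of "of_real \<alpha>"] exp_Euler[of "- of_real \<alpha>"] by simp_all
  have S: "D.mellin 1 (- s) + D.mellin (- 1) (- s) = K * (cos (of_real \<alpha>) * (M 1 + M (- 1)) - sin (of_real \<alpha>) * (\<i> * (M 1 - M (- 1))))"
    unfolding M' e1 by (simp add: algebra_simps)
  have T: "\<i> * (D.mellin 1 (- s) - D.mellin (- 1) (- s)) = - K * (cos (of_real \<alpha>) * (\<i> * (M 1 - M (- 1))) + sin (of_real \<alpha>) * (M 1 + M (- 1)))"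
    unfolding M' e1 by (simp add: algebra_simps)
  \<comment> \<open>The sine in the reflection formula is split into half angles, so that its
    factors cancel the denominators 2 cos a and 2 sin a of \<open>zeta_cont\<close>.\<close>
  have R: "rGamma (- s) = - (Gamma (s + 1) * (2 * sin a * cos a) / of_real pi)"
  proof -
    have "Gamma (- s) * Gamma (1 + s) = - (of_real pi / sin (of_real pi * s))"
      using Gamma_reflection_complex[of "- s"] by simp
    moreover have "sin (of_real pi * s) = 2 * sin a * cos a"
      using sin_double[of a] by (simp add: a_def)
    ultimately show ?thesis
      using nz(4) ca by (simp add: rGamma_inverse_Gamma field_simps)
  qed
  have XG: "X s * of_real pi = K * 2 powr s * G * Gamma (s + 1)"
    by (simp add: X_def G_def)
  show "D.zeta_cont Plus s = X s * (- (2 * sin a * cos b * cos (of_real \<alpha>)) * zeta_cont Plus (- s - of_real \<nu>)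
        - 2 * sin a * sin b * sin (of_real \<alpha>) * zeta_cont Minus (- s - of_real \<nu>))"
  proof -
    have "D.zeta_cont Plus s = 2 powr s * rGamma (- s) * (K * (cos (of_real \<alpha>) * (2 * cos b * G * Zp) - sin (of_real \<alpha>) * (- 2 * sin b * G * Zm))) / (2 * cos a)"
      by (simp only: D.zeta_cont_def parity.case S Msum Mdiff a_def)
    also have "\<dots> = (K * 2 powr s * G * Gamma (s + 1)) / of_real pi * (- (2 * sin a * cos b * cos (of_real \<alpha>)) * Zp - 2 * sin a * sin b * sin (of_real \<alpha>) * Zm)"
      unfolding R using ca by (simp add: field_simps)
    finally show ?thesis unfolding XG[symmetric] Zp_def Zm_def by simp
  qed
  show "D.zeta_cont Minus s = X s * (2 * cos a * cos b * sin (of_real \<alpha>) * zeta_cont Plus (- s - of_real \<nu>)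
        - 2 * cos a * sin b * cos (of_real \<alpha>) * zeta_cont Minus (- s - of_real \<nu>))"
  proof -
    have "D.zeta_cont Minus s = 2 powr s * rGamma (- s) * (\<i> * (D.mellin 1 (- s) - D.mellin (- 1) (- s))) / (2 * sin a)"
      by (simp add: D.zeta_cont_def a_def)
    also have "\<dots> = 2 powr s * rGamma (- s) * (- K * (cos (of_real \<alpha>) * (- 2 * sin b * G * Zm) + sin (of_real \<alpha>) * (2 * cos b * G * Zp))) / (2 * sin a)"
      by (simp only: T Msum Mdiff)
    also have "\<dots> = (K * 2 powr s * G * Gamma (s + 1)) / of_real pi * (2 * cos a * cos b * sin (of_real \<alpha>) * Zp - 2 * cos a * sin b * cos (of_real \<alpha>) * Zm)"
      unfolding R using ca by (simp add: field_simps)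
    finally show ?thesis unfolding XG[symmetric] Zp_def Zm_def by simp
  qed
qed

text \<open>The power 2^(2 s + n) collects 2^(n/2) from the Gaussian constant, and 2^s and 2^(s +
  n/2) from the halved quadratic form on the two sides. The power of pi is pi^(n/2) from the
  Gaussian constant, divided by the pi of the reflection formula.\<close>

lemma gamma_factor_eq:
  "gamma_factor n s = of_real (sqrt (2 * pi)) ^ n * (2 powr s * 2 powr (s + of_real (real n / 2))) *
     Gamma (s + 1) * Gamma (s + of_real (real n / 2)) / of_real pi"
proof -
  have "sqrt (2 * pi) ^ n = 2 powr (real n / 2) * pi powr (real n / 2)"
    by (simp add: powr_half_sqrt[symmetric] powr_mult powr_powr flip: powr_realpow)
  moreover have "pi powr (real n / 2) = pi powr (real n / 2 - 1) * pi"
    by (simp add: powr_diff)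
  ultimately have "complex_of_real (sqrt (2 * pi) ^ n) = of_real (2 powr (real n / 2)) * of_real (pi powr (real n / 2 - 1)) * of_real pi"
    by simp
  also have "complex_of_real (2 powr (real n / 2)) = 2 powr (of_real (real n / 2))"
    using powr_of_real[of 2 "real n / 2"] by simp
  finally have k: "complex_of_real (sqrt (2 * pi)) ^ n = 2 powr (of_real (real n / 2)) * of_real (pi powr (real n / 2 - 1)) * of_real pi"
    by simp
  have "2 powr (of_real (real n / 2)) * (2 powr s * 2 powr (s + of_real (real n / 2))) = (2 powr (2 * s + of_nat n) :: complex)"
    by (simp add: algebra_simps flip: powr_add)
  then show ?thesis
    unfolding gamma_factor_def k by (simp add: mult_ac)
qed

theorem theorem3p2:
  fixes f :: "real ^ ('p::finite + 'q::finite) \<Rightarrow> complex"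
    and p q n :: nat
  assumes "CARD('p) = p" and "CARD('q) = q"
    and "p \<ge> 2" and "q \<ge> 1" and "n = p + q"
    and "schwartz f"
  shows "\<forall>\<^sub>\<approx>s\<in>UNIV.
    (vector [zeta Plus (fourier f) s, zeta Minus (fourier f) s] :: complex ^ 2) =
      gamma_factor n s *s
        (A_matrix p q s *v
          vector [zeta Plus f (- s - of_nat n / 2), zeta Minus f (- s - of_nat n / 2)])"
proof -
  define K where "K = complex_of_real (sqrt (2 * pi)) ^ n"
  define \<alpha> where "\<alpha> = (real p - real q) * pi / 4"
  define \<nu> where "\<nu> = real n / 2"
  interpret osc_dual f "fourier f" K \<alpha> \<nu>
    using osc_dual_fourier[OF assms(6)] unfolding K_def \<alpha>_def \<nu>_def assms(1,2,5) by simp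
  interpret D: osc_dual "fourier f" f "inverse K" \<alpha> \<nu> by (rule swap)
  have \<nu>': "complex_of_real \<nu> = of_nat n / 2" by (simp add: \<nu>_def)
  have \<alpha>': "(of_nat p - of_nat q) * complex_of_real pi / 4 = of_real \<alpha>" by (simp add: \<alpha>_def)
  have "\<forall>\<^sub>\<approx>s\<in>UNIV. zeta \<epsilon> f (- s - of_real \<nu>) = zeta_cont \<epsilon> (- s - of_real \<nu>)" for \<epsilon>
    by (rule cosparse_reflect[OF zeta_eq_zeta_cont])
  moreover have "\<forall>\<^sub>\<approx>s\<in>UNIV. - s - of_real \<nu> \<notin> (\<int> :: complex set)"
    by (rule cosparse_reflect[OF cosparse_not_Ints])
  \<comment> \<open>Finitely many conditions, each valid off a discrete set, at s and at the
    reflected point: no angle degenerates, and all four zeta functions equal their explicit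
    continuations.\<close>
  ultimately have "\<forall>\<^sub>\<approx>s\<in>UNIV. s \<notin> \<int> \<and> - s - of_real \<nu> \<notin> \<int> \<and>
      zeta Plus (fourier f) s = D.zeta_cont Plus s \<and> zeta Minus (fourier f) s = D.zeta_cont Minus s \<and>
      zeta Plus f (- s - of_real \<nu>) = zeta_cont Plus (- s - of_real \<nu>) \<and>
      zeta Minus f (- s - of_real \<nu>) = zeta_cont Minus (- s - of_real \<nu>)"
    using D.zeta_eq_zeta_cont cosparse_not_Ints by (simp add: eventually_conj_iff)
  then show ?thesis
  proof eventually_elim
    case (elim s)
    \<comment> \<open>With these half angles the arguments in \<open>A_matrix\<close> are a + b and
      b - a, and its sums of sines and cosines become the products in the functional
      equation.\<close>
    define a where "a = of_real pi * s / 2"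
    define b where "b = of_real pi * (s + of_real \<nu>) / 2"
    define Zp where "Zp = zeta Plus f (- s - of_nat n / 2)"
    define Zm where "Zm = zeta Minus f (- s - of_nat n / 2)"
    have g: "gamma_factor n s = K * (2 powr s * 2 powr (s + of_real \<nu>)) * Gamma (s + 1) * Gamma (s + of_real \<nu>) / of_real pi"
      unfolding gamma_factor_eq K_def \<nu>_def ..
    have \<sigma>: "(s + of_nat (p + q) / 4) * of_real pi = a + b"
      by (simp add: a_def b_def \<nu>_def assms(5) field_simps)
    have \<beta>: "of_nat (p + q) * of_real pi / 4 = b - a"
      by (simp add: a_def b_def \<nu>_def assms(5) field_simps)
    have trig: "sin (b - a) - sin (a + b) = - (2 * sin a * cos b)" "cos (a + b) - cos (b - a) = - (2 * sin a * sin b)"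
      "cos (a + b) + cos (b - a) = 2 * cos a * cos b" "sin (b - a) + sin (a + b) = 2 * cos a * sin b"
      by (simp_all add: sin_add sin_diff cos_add cos_diff)
    have P: "zeta Plus (fourier f) s = gamma_factor n s * (- (2 * sin a * cos b * cos (of_real \<alpha>)) * Zp - 2 * sin a * sin b * sin (of_real \<alpha>) * Zm)"
      using elim zeta_cont_functional_equation(1)[of s] by (simp add: g a_def b_def Zp_def Zm_def \<nu>')
    have M: "zeta Minus (fourier f) s = gamma_factor n s * (2 * cos a * cos b * sin (of_real \<alpha>) * Zp - 2 * cos a * sin b * cos (of_real \<alpha>) * Zm)"
      using elim zeta_cont_functional_equation(2)[of s] by (simp add: g a_def b_def Zp_def Zm_def \<nu>')
    show ?case
      unfolding P M Zp_def[symmetric] Zm_def[symmetric] A_matrix_def Let_def \<alpha>' \<sigma> \<beta> trig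
      by (simp add: vec_eq_iff forall_2 matrix_vector_mult_def sum_2 vector_2 algebra_simps)
  qed
qed

end
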